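(* Let $\lambda\in[-1,1)$, let $I\subset\mathbb{R}$ be an interval and let $\gamma:I\to\mathbb{R}^2$ be a $\lambda$-eel with bounded image. Then $\gamma$ is rectifiable and has finite length.
   Context: $\mathbb{R}^2$ carries the Euclidean inner product $\langle\cdot,\cdot\rangle$ and norm $\|\cdot\|$. For $\lambda\in[-1,1)$, a $\lambda$-eel is a continuous curve $\gamma:I\to\mathbb{R}^d$ which has at each point a nonzero right derivative $\gamma'(\tau)$ and satisfies, for all $t<\tau$ in $I$, $\langle\gamma'(\tau),\gamma(t)-\gamma(\tau)\rangle\le\lambda\,\|\gamma'(\tau)\|\,\|\gamma(t)-\gamma(\tau)\|$. The length of $\gamma$ is $\sup\sum_{i=0}^{m-1}\|\gamma(t_i)-\gamma(t_{i+1})\|$ over finite increasing sequences $t_0<\dots<t_m$ in $I$; $\gamma$ is rectifiable if its length is finite on every compact subinterval of $I$. *)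

theory Defs
  imports "HOL-Analysis.Analysis"
begin

definition is_eel :: "real \<Rightarrow> real set \<Rightarrow> (real \<Rightarrow> 'a::real_inner) \<Rightarrow> bool" where
  "is_eel lam I \<gamma> \<longleftrightarrow> continuous_on I \<gamma> \<and>
     (\<forall>\<tau>\<in>I. \<exists>v. v \<noteq> 0 \<and> (\<gamma> has_vector_derivative v) (at \<tau> within (I \<inter> {\<tau><..})) \<and>
        (\<forall>t\<in>I. t < \<tau> \<longrightarrow>
           inner v (\<gamma> t - \<gamma> \<tau>) \<le> lam * norm v * norm (\<gamma> t - \<gamma> \<tau>)))"

definition curve_length :: "(real \<Rightarrow> 'a::metric_space) \<Rightarrow> real set \<Rightarrow> ennreal" where
  "curve_length \<gamma> I = (SUP ts \<in> {ts. sorted_wrt (<) ts \<and> set ts \<subseteq> I}.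
      ennreal (\<Sum>i < length ts - 1. dist (\<gamma> (ts ! i)) (\<gamma> (ts ! Suc i))))"

definition rectifiable_curve :: "(real \<Rightarrow> 'a::metric_space) \<Rightarrow> real set \<Rightarrow> bool" where
  "rectifiable_curve \<gamma> I \<longleftrightarrow> (\<forall>a b. {a..b} \<subseteq> I \<longrightarrow> curve_length \<gamma> {a..b} < \<infinity>)"

end

(* At a point of an eel whose past is seen, as a connected set of directions, within an angle
   pi - alpha (with cos alpha = lambda), the velocity is at angle at least alpha from all of it. Hence
   some direction n is a support direction of the past at the current point and has positive inner
   product with the velocity. Finitely many n suffice, so the sum of the support functions of the past
   in these directions grows at least proportionally to the displacement; being bounded, it bounds
   the length.

   That the past spans an angle at most pi - alpha propagates in time: when the angle between two
   past points exceeds pi - alpha, the velocity lies neither near them nor between them, so the opposite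
   direction is between them and the angle shrinks. The only difficulty is to start this process, where
   the curve might wind or intersect itself at arbitrarily small scales; a Baire category
   argument for the right derivative excludes this. *)
theory Submission
  imports Defs
begin

section \<open>Angles in the complex plane\<close>

text \<open>The level \<open>pi - \<alpha> / 2\<close> replaces the angle pi - alpha of the
  overview. It lies strictly above pi - alpha, which makes the angle strictly decrease where it
  meets the level, and strictly below pi, which leaves a sector free of past directions and hence a
  continuous choice of angle. The slack alpha / 2 pays for the later constants: the thin cones used
  for gluing and the margins of the support directions both have size alpha / 8. A recurring
  obstacle is that inner products determine angles only modulo 2 pi and up to sign. Real angles are
  recovered from connectedness: the past is the continuous image of an interval, so a choice of
  angle that went beyond pi would have to take the value pi, and a velocity direction enclosed by
  past directions would have to be one of them. Both need the current point to differ from all past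
  ones, so injectivity must come out of a crude spread bound before that bound can be
  sharpened.\<close>

lemma polar: "z = complex_of_real (cmod z) * cis (Arg z)"
  using rcis_cmod_Arg[of z] by (simp add: rcis_def)

lemma inner_complex_mult_left: "inner (w * p) (w * q) = (cmod w)\<^sup>2 * inner p (q::complex)"
  unfolding cmod_power2 by (simp add: inner_complex_def power2_eq_square algebra_simps)

lemma inner_of_real_cis:
  "inner (complex_of_real p * (w * cis a)) (complex_of_real q * (w * cis b)) = p * q * (cmod w)\<^sup>2 * cos (a - b)"
proof -
  have "inner (complex_of_real p * (w * cis a)) (complex_of_real q * (w * cis b))
     = inner (w * (of_real p * cis a)) (w * (of_real q * cis b))" by (simp add: mult_ac)
  also have "\<dots> = (cmod w)\<^sup>2 * inner (of_real p * cis a) (of_real q * cis b)"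
    by (rule inner_complex_mult_left)
  also have "inner (complex_of_real p * cis a) (of_real q * cis b) = p * q * cos (a - b)"
    by (simp add: inner_complex_def cos_diff algebra_simps)
  finally show ?thesis by simp
qed

lemma inner_Arg_diff: "inner p q = cmod p * cmod q * cos (Arg p - Arg q)"
  using inner_of_real_cis[of "cmod p" 1 "Arg p" "cmod q" "Arg q"] polar[of p] polar[of q] by simp

lemma cos_ge_imp_abs_le:
  assumes "cos B \<le> cos d" "\<bar>d\<bar> \<le> pi" "0 \<le> B" "B \<le> pi"
  shows "\<bar>d\<bar> \<le> B"
proof (rule ccontr)
  assume "\<not> ?thesis"
  then have "cos \<bar>d\<bar> < cos B" using assms by (intro cos_monotone_0_pi) auto
  then show False using assms by simp
qed

lemma abs_Arg_le_iff:
  assumes "z \<noteq> 0" "0 \<le> A" "A \<le> pi"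
  shows "\<bar>Arg z\<bar> \<le> A \<longleftrightarrow> cos A * cmod z \<le> Re z"
proof -
  have 1: "Re z = cmod z * cos (Arg z)" using cos_Arg[OF assms(1)] assms(1) by simp
  have 2: "cmod z > 0" using assms by simp
  have "cos A * cmod z \<le> Re z \<longleftrightarrow> cos A \<le> cos (Arg z)"
    using 1 2 by (simp add: mult.commute)
  moreover have "cos A \<le> cos (Arg z) \<longleftrightarrow> \<bar>Arg z\<bar> \<le> A"
    using cos_ge_imp_abs_le[of A "Arg z"] assms Arg_bounded[of z] cos_monotone_0_pi_le[of "\<bar>Arg z\<bar>" A]
    by auto
  ultimately show ?thesis by simp
qed

text \<open>Triangle inequality on the circle. \<open>A + C \<le> pi\<close> keeps
  \<open>f - y\<close> from wrapping beyond \<open>2 * pi - A\<close>; equality there forces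
  \<open>C = pi - A\<close> and \<bar>f\<bar> = pi, where the bound holds anyway.\<close>

lemma angle_triangle:
  assumes "cos A \<le> cos (f - y)" "\<bar>y\<bar> \<le> C" "0 \<le> A" "0 \<le> C" "A + C \<le> pi" "\<bar>f\<bar> \<le> pi"
  shows "cos (A + C) \<le> cos f"
proof -
  have "\<bar>f\<bar> \<le> A + C"
  proof (rule ccontr)
    assume n: "\<not> ?thesis"
    have "\<bar>f - y\<bar> \<le> 2 * pi - A"
      using assms by linarith
    moreover have "\<bar>f - y\<bar> > A" using n assms by linarith
    ultimately have "cos \<bar>f - y\<bar> < cos A \<or> \<bar>f - y\<bar> = 2 * pi - A"
    proof (cases "\<bar>f - y\<bar> \<le> pi")
      case True
      then show ?thesis using \<open>\<bar>f - y\<bar> > A\<close> assms cos_monotone_0_pi[of A "\<bar>f-y\<bar>"] by auto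
    next
      case False
      have "cos (2 * pi - \<bar>f - y\<bar>) < cos A" if "\<bar>f - y\<bar> \<noteq> 2 * pi - A"
        using False \<open>\<bar>f - y\<bar> \<le> 2 * pi - A\<close> assms(3) that by (intro cos_monotone_0_pi) linarith+
      then show ?thesis by (auto simp: cos_diff)
    qed
    then have "\<bar>f - y\<bar> = 2 * pi - A" using assms(1) by auto
    then have "C = pi - A" "\<bar>f\<bar> = pi" using assms by linarith+
    then show False using n by simp
  qed
  then show ?thesis using assms cos_monotone_0_pi_le[of "\<bar>f\<bar>" "A + C"] by simp
qed

text \<open>The angle from z to the positive real axis is estimated through w. Products in place of
  quotients admit z = 0.\<close>

lemma Re_ge_cos_triangle:
  assumes "w \<noteq> 0" "cos A * (cmod z * cmod w) \<le> inner z w" "cos C * cmod w \<le> Re w"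
    "0 \<le> A" "0 \<le> C" "A + C \<le> pi"
  shows "cos (A + C) * cmod z \<le> Re z"
proof (cases "z = 0")
  case False
  have "cos A \<le> cos (Arg z - Arg w)"
    using assms(2) False assms(1) unfolding inner_Arg_diff by (simp add: mult.commute)
  moreover have "\<bar>Arg w\<bar> \<le> C" using abs_Arg_le_iff[of w C] assms by simp
  ultimately have "cos (A + C) \<le> cos (Arg z)"
    using assms angle_triangle[of A "Arg z" "Arg w" C] Arg_bounded[of z] by auto
  then show ?thesis using False by (simp add: cos_Arg field_simps)
qed simp

text \<open>Adding w raises the real part by at least \<open>e * cmod w\<close> and lowers
  \<open>c * cmod z\<close> by at most \<open>c * cmod w\<close>. The cone of z has half-angle at
  least pi / 2 and need not be closed under addition; the thinner cone of w compensates.\<close>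

lemma Re_ge_cos_add:
  assumes "- c * cmod z \<le> Re z" "e * cmod w \<le> Re w" "c < e" "0 \<le> c" "w \<noteq> 0"
  shows "- c * cmod (z + w) \<le> Re (z + w)" "z + w \<noteq> 0"
proof -
  have "cmod z \<le> cmod (z + w) + cmod w"
    using norm_triangle_ineq4[of "z + w" w] by simp
  then have "c * cmod z \<le> c * (cmod (z + w) + cmod w)" using assms by (simp add: mult_left_mono)
  then have "- c * cmod (z + w) + (e - c) * cmod w \<le> Re (z + w)"
    using assms by (simp add: algebra_simps)
  moreover have "(e - c) * cmod w > 0" using assms by simp
  ultimately have *: "- c * cmod (z + w) < Re (z + w)" by linarith
  then show "- c * cmod (z + w) \<le> Re (z + w)" by simp
  from * show "z + w \<noteq> 0" by fastforce
qed

lemma cos_le_cos_range: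
  assumes "cos t \<le> cos \<alpha>" "0 \<le> t" "t \<le> 2 * pi" "0 \<le> \<alpha>" "\<alpha> \<le> pi"
  shows "\<alpha> \<le> t" "t \<le> 2 * pi - \<alpha>"
proof -
  show "\<alpha> \<le> t"
    using assms cos_monotone_0_pi[of t \<alpha>] by (meson linorder_not_le)
  show "t \<le> 2 * pi - \<alpha>"
  proof (rule ccontr)
    assume "\<not> ?thesis"
    then have "cos (2 * pi - t) > cos \<alpha>" using assms cos_monotone_0_pi[of "2 * pi - t" \<alpha>] by auto
    then show False using assms by (simp add: cos_diff)
  qed
qed

text \<open>Here \<open>g\<close> is a continuous choice of the angle under which a moving point \<open>x\<close> sees \<open>A\<close> and \<open>B\<close>.
  When \<open>g = \<beta>\<close>, the velocity makes an angle at least \<open>\<alpha>\<close> with both directions and does not lie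
  between them; since \<open>\<beta> + \<alpha> > pi\<close>, the opposite direction then lies strictly between them, so that
  the angle is decreasing. The sign of the derivative is read off the imaginary part \<open>S\<close>, which is
  a positive multiple of \<open>sin (g - \<beta>)\<close>.\<close>

lemma angle_barrier:
  fixes x :: "real \<Rightarrow> complex"
  assumes cont: "continuous_on {t0..t1} x" and gc: "continuous_on {t0..t1} g"
    and ranges: "0 < \<alpha>" "\<alpha> \<le> pi/2" "pi - \<alpha> < \<beta>" "\<beta> < pi"
    and start: "g t0 \<le> \<beta>" and tt: "t0 \<le> t1"
    and der: "\<And>\<tau>. t0 \<le> \<tau> \<Longrightarrow> \<tau> < t1 \<Longrightarrow> (x has_vector_derivative v \<tau>) (at_right \<tau>)"
    and vnz: "\<And>\<tau>. t0 \<le> \<tau> \<Longrightarrow> \<tau> < t1 \<Longrightarrow> v \<tau> \<noteq> 0"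
    and nz: "\<And>\<tau>. t0 \<le> \<tau> \<Longrightarrow> \<tau> \<le> t1 \<Longrightarrow> A - x \<tau> \<noteq> 0 \<and> B - x \<tau> \<noteq> 0"
    and lift: "\<And>\<tau>. t0 \<le> \<tau> \<Longrightarrow> \<tau> \<le> t1 \<Longrightarrow> \<exists>k>0. B - x \<tau> = of_real k * ((A - x \<tau>) * cis (g \<tau>))"
    and eelA: "\<And>\<tau>. t0 \<le> \<tau> \<Longrightarrow> \<tau> < t1 \<Longrightarrow> inner (v \<tau>) (A - x \<tau>) \<le> cos \<alpha> * (norm (v \<tau>) * norm (A - x \<tau>))"
    and eelB: "\<And>\<tau>. t0 \<le> \<tau> \<Longrightarrow> \<tau> < t1 \<Longrightarrow> inner (v \<tau>) (B - x \<tau>) \<le> cos \<alpha> * (norm (v \<tau>) * norm (B - x \<tau>))"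
    and out: "\<And>\<tau> \<theta> k. t0 \<le> \<tau> \<Longrightarrow> \<tau> < t1 \<Longrightarrow> g \<tau> = \<beta> \<Longrightarrow> 0 \<le> \<theta> \<Longrightarrow> \<theta> \<le> \<beta> \<Longrightarrow> 0 < k \<Longrightarrow>
       v \<tau> \<noteq> of_real k * ((A - x \<tau>) * cis \<theta>)"
  shows "g t1 \<le> \<beta>"
proof (rule ccontr)
  assume "\<not> ?thesis"
  then have gt: "g t1 > \<beta>" by simp
  \<comment> \<open>The last time at which the barrier is respected: there g equals \<beta>, and g
    exceeds \<beta> from then on.\<close>
  define T where "T = {\<tau>\<in>{t0..t1}. g \<tau> \<le> \<beta>}"
  have cT: "compact T" unfolding T_def
  proof -
    have "closed {\<tau>\<in>{t0..t1}. g \<tau> \<le> \<beta>}"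
      by (intro continuous_on_closed_Collect_le continuous_intros gc)
    moreover have "bounded {\<tau>\<in>{t0..t1}. g \<tau> \<le> \<beta>}" by (rule bounded_subset[of "{t0..t1}"]) auto
    ultimately show "compact {\<tau>\<in>{t0..t1}. g \<tau> \<le> \<beta>}" by (simp add: compact_eq_bounded_closed)
  qed
  have Tne: "T \<noteq> {}" using start tt by (auto simp: T_def)
  obtain \<tau> where \<tau>: "\<tau> \<in> T" and last: "\<And>s. s \<in> T \<Longrightarrow> s \<le> \<tau>"
    using compact_attains_sup[OF cT Tne] by blast
  have r: "t0 \<le> \<tau>" "\<tau> < t1" using \<tau> gt by (auto simp: T_def less_le)
  have after: "g s > \<beta>" if "\<tau> < s" "s \<le> t1" for s using last[of s] that r by (force simp: T_def)
  have g\<tau>: "g \<tau> = \<beta>"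
  proof (rule ccontr)
    assume "g \<tau> \<noteq> \<beta>"
    then have "g \<tau> < \<beta>" using \<tau> by (auto simp: T_def)
    moreover have "continuous_on {\<tau>..t1} g" by (rule continuous_on_subset[OF gc]) (use r in auto)
    ultimately obtain s where s: "\<tau> \<le> s" "s \<le> t1" "g s = \<beta>"
      using IVT'[of g \<tau> \<beta> t1] r gt by auto
    with after[of s] \<open>g \<tau> \<noteq> \<beta>\<close> show False by (cases "s = \<tau>") auto
  qed
  define p q where "p = A - x \<tau>" and "q = B - x \<tau>"
  have pq: "p \<noteq> 0" "q \<noteq> 0" using nz r by (auto simp: p_def q_def)
  obtain m where m: "m > 0" "q = of_real m * (p * cis \<beta>)"
    using lift[of \<tau>] r g\<tau> by (auto simp: p_def q_def)
  define k where "k = cmod (v \<tau>) / cmod p"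
  have k: "k > 0" using vnz[of \<tau>] r pq by (auto simp: k_def)
  \<comment> \<open>\<open>Arg2pi\<close> has range [0, 2 pi), from which \<open>out\<close> removes
    exactly the initial arc [0, \<beta>].\<close>
  define \<theta> where "\<theta> = Arg2pi (v \<tau> / p)"
  have vp: "v \<tau> / p = of_real k * cis \<theta>"
    using Arg2pi_eq[of "v \<tau> / p"] by (simp add: k_def \<theta>_def norm_divide cis_conv_exp)
  have v: "v \<tau> = of_real k * (p * cis \<theta>)" using vp pq by (simp add: field_simps)
  have \<theta>r: "0 \<le> \<theta>" "\<theta> < 2 * pi" using Arg2pi[of "v \<tau> / p"] by (auto simp: \<theta>_def)
  have \<theta>b: "\<theta> > \<beta>" using out[of \<tau> \<theta> k] r g\<tau> k v \<theta>r by (force simp: p_def)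
  have cp: "cmod (v \<tau>) = k * cmod p" using k v by (simp add: norm_mult)
  have cq: "cmod q = m * cmod p" using m by (simp add: norm_mult)
  have "inner (v \<tau>) p = k * (cmod p)\<^sup>2 * cos \<theta>"
    using inner_of_real_cis[of k p \<theta> 1 0] v by simp
  then have "k * (cmod p)\<^sup>2 * cos \<theta> \<le> k * (cmod p)\<^sup>2 * cos \<alpha>"
    using eelA[of \<tau>] r cp by (simp add: p_def power2_eq_square algebra_simps)
  then have c1: "cos \<theta> \<le> cos \<alpha>" using k pq by simp
  have "inner (v \<tau>) q = k * m * (cmod p)\<^sup>2 * cos (\<theta> - \<beta>)"
    using inner_of_real_cis[of k p \<theta> m \<beta>] v m by simp
  then have "k * m * (cmod p)\<^sup>2 * cos (\<theta> - \<beta>) \<le> k * m * (cmod p)\<^sup>2 * cos \<alpha>"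
    using eelB[of \<tau>] r cp cq by (simp add: q_def power2_eq_square algebra_simps)
  then have c2: "cos (\<theta> - \<beta>) \<le> cos \<alpha>" using k m pq by simp
  have "\<theta> \<le> 2 * pi - \<alpha>" using cos_le_cos_range(2)[OF c1] \<theta>r ranges by simp
  have "\<alpha> \<le> \<theta> - \<beta>" by (rule cos_le_cos_range(1)[OF c2]) (use \<theta>r \<theta>b ranges in auto)
  have s1: "sin \<theta> < 0" using \<open>\<alpha> \<le> \<theta> - \<beta>\<close> ranges \<theta>r by (intro sin_lt_zero) auto
  have s2: "sin (\<theta> - \<beta>) > 0"
    using \<open>\<alpha> \<le> \<theta> - \<beta>\<close> \<open>\<theta> \<le> 2 * pi - \<alpha>\<close> ranges by (intro sin_gt_zero) auto
  \<comment> \<open>Unlike g, S is a polynomial in x and its conjugate, so it inherits the right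
    derivative of x.\<close>
  define S where "S s = Im ((B - x s) * cnj (A - x s) * cis (-\<beta>))" for s
  define D where "D = Im ((- v \<tau>) * cnj p * cis (-\<beta>) + q * (- cnj (v \<tau>)) * cis (-\<beta>))"
  have dS: "(S has_real_derivative D) (at_right \<tau>)"
  proof -
    have dx: "(x has_vector_derivative v \<tau>) (at_right \<tau>)" using der r by simp
    have dc: "((\<lambda>s. cnj (A - x s)) has_vector_derivative cnj (- v \<tau>)) (at_right \<tau>)"
      by (rule bounded_linear.has_vector_derivative[OF bounded_linear_cnj])
         (auto intro!: derivative_eq_intros dx)
    have "((\<lambda>s. (B - x s) * cnj (A - x s) * cis (-\<beta>)) has_vector_derivative
        ((- v \<tau>) * cnj p * cis (-\<beta>) + q * (- cnj (v \<tau>)) * cis (-\<beta>))) (at_right \<tau>)"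
      by (rule derivative_eq_intros dx dc refl)+ (simp add: p_def q_def algebra_simps)
    from bounded_linear.has_vector_derivative[OF bounded_linear_Im this]
    show ?thesis by (simp add: S_def[abs_def] D_def has_real_derivative_iff_has_vector_derivative)
  qed
  have "D = - k * (cmod p)\<^sup>2 * (sin (\<theta> - \<beta>) - m * sin \<theta>)"
  proof -
    have pp: "p * cnj p = of_real ((cmod p)\<^sup>2)" by (rule complex_norm_square[symmetric])
    have "(- v \<tau>) * cnj p * cis (-\<beta>) = of_real (- k * (cmod p)\<^sup>2) * cis (\<theta> - \<beta>)"
      using pp by (simp add: v cis_mult[symmetric] diff_conv_add_uminus mult_ac del: add_uminus_conv_diff)
    moreover have "q * (- cnj (v \<tau>)) * cis (-\<beta>) = of_real (- k * m * (cmod p)\<^sup>2) * cis (- \<theta>)"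
    proof -
      have "q * (- cnj (v \<tau>)) * cis (-\<beta>) = - of_real (k * m) * (p * cnj p) * cis (- \<theta>) * (cis \<beta> * cis (-\<beta>))"
        by (simp add: v m cis_cnj mult_ac)
      then show ?thesis by (simp add: pp cis_mult)
    qed
    ultimately show ?thesis by (simp add: D_def algebra_simps)
  qed
  moreover have "\<dots> < 0"
  proof -
    have "m * sin \<theta> < 0" using m s1 by (simp add: mult_pos_neg)
    then have "sin (\<theta> - \<beta>) - m * sin \<theta> > 0" using s2 by linarith
    then show ?thesis using k pq by simp
  qed
  ultimately have "D < 0" by simp
  from has_real_derivative_neg_dec_right[OF dS this]
  obtain d where d: "d > 0" "\<And>h. h > 0 \<Longrightarrow> h < d \<Longrightarrow> S (\<tau> + h) < S \<tau>" by auto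
  have "S \<tau> = 0"
  proof -
    have "q * cnj p * cis (-\<beta>) = of_real m * (p * cnj p) * (cis \<beta> * cis (-\<beta>))"
      by (simp add: m mult_ac)
    also have "\<dots> = of_real (m * (cmod p)\<^sup>2)"
      by (simp add: cis_mult flip: complex_norm_square)
    finally have "q * cnj p * cis (-\<beta>) = of_real (m * (cmod p)\<^sup>2)" .
    then show ?thesis unfolding S_def p_def[symmetric] q_def[symmetric] by simp
  qed
  \<comment> \<open>The sine of \<open>g s - \<beta>\<close> is known to be positive only while g
    stays between \<beta> and \<beta> + pi; continuity of g supplies the upper limit.\<close>
  have "\<forall>\<^sub>F s in at_right \<tau>. g s < \<beta> + pi"
  proof -
    have "(g \<longlongrightarrow> g \<tau>) (at \<tau> within {t0..t1})" using gc r by (auto simp: continuous_on_def)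
    then have "(g \<longlongrightarrow> g \<tau>) (at \<tau> within {\<tau>..t1})" by (rule tendsto_within_subset) (use r in auto)
    then have "(g \<longlongrightarrow> \<beta>) (at_right \<tau>)"
      using r g\<tau> by (simp add: at_within_Icc_at_right)
    then show ?thesis by (rule order_tendstoD) simp
  qed
  moreover have "\<forall>\<^sub>F s in at_right \<tau>. s < \<tau> + d" "\<forall>\<^sub>F s in at_right \<tau>. s < t1"
    using eventually_at_right_real[of \<tau> "\<tau> + d"] eventually_at_right_real[of \<tau> t1] d r
    by (auto elim: eventually_mono)
  moreover have "\<forall>\<^sub>F s in at_right \<tau>. s > \<tau>" by (simp add: eventually_at_right_less)
  ultimately have "\<forall>\<^sub>F s in at_right \<tau>. False"
  proof eventually_elim
    case (elim s)
    have "S s < 0" using d(2)[of "s - \<tau>"] elim \<open>S \<tau> = 0\<close> by simp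
    obtain k' where k': "k' > 0" "B - x s = of_real k' * ((A - x s) * cis (g s))" using lift[of s] elim r by auto
    have "(B - x s) * cnj (A - x s) * cis (-\<beta>)
        = of_real k' * ((A - x s) * cnj (A - x s)) * (cis (g s) * cis (-\<beta>))"
      by (subst k'(2)) (simp only: mult_ac)
    also have "\<dots> = of_real (k' * (cmod (A - x s))\<^sup>2) * cis (g s - \<beta>)"
      by (simp only: cis_mult complex_norm_square[symmetric] of_real_mult diff_conv_add_uminus)
    finally have "(B - x s) * cnj (A - x s) * cis (-\<beta>)
        = of_real (k' * (cmod (A - x s))\<^sup>2) * cis (g s - \<beta>)" .
    then have "S s = k' * (cmod (A - x s))\<^sup>2 * sin (g s - \<beta>)" by (simp add: S_def)
    moreover have "sin (g s - \<beta>) > 0" using after[of s] elim by (intro sin_gt_zero) auto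
    moreover have "k' * (cmod (A - x s))\<^sup>2 > 0" using k' nz[of s] elim r by auto
    ultimately show False using \<open>S s < 0\<close> by (metis mult_pos_pos less_asym)
  qed
  then show False by simp
qed

lemma cos_Arg_divide:
  assumes "p \<noteq> 0" "q \<noteq> 0"
  shows "cos (Arg (p / q)) = inner p q / (cmod p * cmod q)"
proof -
  have "Re (p / q) = inner p q / (cmod q)\<^sup>2"
    by (simp add: Re_divide inner_complex_def cmod_power2)
  then show ?thesis using assms by (simp add: cos_Arg norm_divide field_simps power2_eq_square)
qed

lemma polar_divide:
  assumes "q \<noteq> 0"
  shows "p = complex_of_real (cmod p / cmod q) * (q * cis (Arg (p / q)))"
  using polar[of "p / q"] assms by (simp add: norm_divide field_simps)

lemma cos_le_inner_self: "cos B * (cmod z * cmod z) \<le> inner z z"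
  using mult_right_mono[OF cos_le_one[of B], of "(cmod z)\<^sup>2"]
  by (simp add: dot_square_norm power2_eq_square)

lemma not_nonpos_Reals_if_abs_Arg_less:
  assumes "z \<noteq> 0" "\<bar>Arg z\<bar> < pi"
  shows "z \<notin> \<real>\<^sub>\<le>\<^sub>0"
proof
  assume "z \<in> \<real>\<^sub>\<le>\<^sub>0"
  then have "Arg z = pi"
    using assms(1) unfolding Arg_eq_pi complex_nonpos_Reals_iff complex_eq_iff by auto
  then show False using assms by simp
qed

section \<open>The spread of the past of a curve\<close>

text \<open>The past of the curve is seen from each of its points under pairwise angles at most \<open>B\<close>,
  as \<open>inner p q = cmod p * cmod q * cos\<close> of the angle between \<open>p\<close> and \<open>q\<close>. In this product form
  the condition is closed, and a point that is visited twice does not violate it by itself.\<close>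

definition spread :: "(real \<Rightarrow> complex) \<Rightarrow> real \<Rightarrow> real set \<Rightarrow> bool" where
  "spread x B S \<longleftrightarrow> (\<forall>r\<in>S. \<forall>r'\<in>S. \<forall>\<tau>\<in>S. r \<le> \<tau> \<longrightarrow> r' \<le> \<tau> \<longrightarrow>
     cos B * (cmod (x r - x \<tau>) * cmod (x r' - x \<tau>)) \<le> inner (x r - x \<tau>) (x r' - x \<tau>))"

lemma spreadD:
  "spread x B S \<Longrightarrow> r \<in> S \<Longrightarrow> r' \<in> S \<Longrightarrow> \<tau> \<in> S \<Longrightarrow> r \<le> \<tau> \<Longrightarrow> r' \<le> \<tau> \<Longrightarrow>
    cos B * (cmod (x r - x \<tau>) * cmod (x r' - x \<tau>)) \<le> inner (x r - x \<tau>) (x r' - x \<tau>)"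
  by (auto simp: spread_def)

lemma spread_subset: "spread x B S \<Longrightarrow> T \<subseteq> S \<Longrightarrow> spread x B T"
  by (auto simp: spread_def)

text \<open>Opposite directions have cosine -1, which is below \<open>cos B\<close>. Thus quotients
  of past directions avoid the branch cut of \<open>Arg\<close>, and their argument is continuous in
  every parameter.\<close>

lemma spread_not_nonpos:
  assumes "spread x B S" "r \<in> S" "r' \<in> S" "\<tau> \<in> S" "r \<le> \<tau>" "r' \<le> \<tau>" "0 \<le> B" "B < pi"
    "x r \<noteq> x \<tau>" "x r' \<noteq> x \<tau>"
  shows "(x r - x \<tau>) / (x r' - x \<tau>) \<notin> \<real>\<^sub>\<le>\<^sub>0"
proof
  assume "(x r - x \<tau>) / (x r' - x \<tau>) \<in> \<real>\<^sub>\<le>\<^sub>0"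
  then have "Arg ((x r - x \<tau>) / (x r' - x \<tau>)) = pi"
  proof -
    have "(x r - x \<tau>) / (x r' - x \<tau>) \<noteq> 0" using assms by simp
    with \<open>(x r - x \<tau>) / (x r' - x \<tau>) \<in> \<real>\<^sub>\<le>\<^sub>0\<close> show ?thesis
      unfolding Arg_eq_pi complex_nonpos_Reals_iff complex_eq_iff by auto
  qed
  then have "-1 = inner (x r - x \<tau>) (x r' - x \<tau>) / (cmod (x r - x \<tau>) * cmod (x r' - x \<tau>))"
    using cos_Arg_divide[of "x r - x \<tau>" "x r' - x \<tau>"] assms by simp
  moreover have "cos B > -1" using cos_monotone_0_pi[of B pi] assms by simp
  moreover have "cmod (x r - x \<tau>) * cmod (x r' - x \<tau>) > 0" using assms by simp
  ultimately have "inner (x r - x \<tau>) (x r' - x \<tau>) < cos B * (cmod (x r - x \<tau>) * cmod (x r' - x \<tau>))"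
    by (smt (verit, best) nonzero_eq_divide_eq mult_less_cancel_right_pos)
  then show False using spreadD[OF assms(1-6)] by simp
qed

text \<open>Contracting \<open>{c..d}\<close> towards its midpoint preserves the order of the three
  times and moves them into the interior; the product form of \<open>spread\<close> passes to the
  limit.\<close>

lemma spread_closure:
  assumes cont: "continuous_on {c..d} x" and "c < d"
    and *: "\<And>c' d'. c < c' \<Longrightarrow> c' < d' \<Longrightarrow> d' < d \<Longrightarrow> spread x B {c'..d'}"
  shows "spread x B {c..d}"
  unfolding spread_def
proof (intro ballI impI)
  fix r r' \<tau> assume H: "r \<in> {c..d}" "r' \<in> {c..d}" "\<tau> \<in> {c..d}" "r \<le> \<tau>" "r' \<le> \<tau>"
  define m where "m = (c + d) / 2"
  define f where "f n y = y + (m - y) * (1 / real (Suc n))" for n y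
  have fconv: "f n y = (1 - 1 / real (Suc n)) * y + (1 / real (Suc n)) * m" for n y
    unfolding f_def by (simp add: divide_simps) (simp add: algebra_simps)
  have mono: "f n y \<le> f n y'" if "y \<le> y'" for n y y'
    unfolding fconv using that by (intro add_right_mono mult_left_mono) auto
  have lim: "(\<lambda>n. x (f n y)) \<longlonglongrightarrow> x y" if "y \<in> {c..d}" for y
  proof -
    have "(\<lambda>n. f n y) \<longlonglongrightarrow> y + (m - y) * 0"
      unfolding f_def by (intro tendsto_intros) (use LIMSEQ_inverse_real_of_nat in \<open>simp add: inverse_eq_divide\<close>)
    moreover have "f n y \<in> {c..d}" for n
    proof -
      have "m \<in> {c..d}" using \<open>c < d\<close> by (auto simp: m_def)
      with that have "(1 - 1 / real (Suc n)) *\<^sub>R y + (1 / real (Suc n)) *\<^sub>R m \<in> {c..d}"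
        by (intro convexD) auto
      then show ?thesis by (simp add: fconv)
    qed
    ultimately show ?thesis
      using continuous_on_tendsto_compose[OF cont, of "\<lambda>n. f n y" y sequentially] that by simp
  qed
  have le: "cos B * (cmod (x (f n r) - x (f n \<tau>)) * cmod (x (f n r') - x (f n \<tau>)))
      \<le> inner (x (f n r) - x (f n \<tau>)) (x (f n r') - x (f n \<tau>))" for n
  proof -
    define e where "e = (m - c) * (1 / real (Suc n))"
    have e: "e > 0" using \<open>c < d\<close> by (simp add: e_def m_def)
    have fc: "f n c = c + e" "f n d = d - e" by (auto simp: f_def e_def m_def field_simps)
    have fb: "f n y \<in> {f n c..f n d}" if "y \<in> {c..d}" for y using mono that by auto
    show ?thesis
    proof (cases "f n c < f n d")
      case True
      show ?thesis
        by (rule spreadD[OF *[of "f n c" "f n d"]]) (use True fc e H fb mono in auto)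
    next
      \<comment> \<open>This is n = 0 only: the factor 1 - 1 / (n + 1) vanishes and everything
        collapses to the midpoint.\<close>
      case False
      then have "f n r = f n c" "f n r' = f n c" "f n \<tau> = f n c"
        using fb[of r] fb[of r'] fb[of \<tau>] H by auto
      then show ?thesis by simp
    qed
  qed
  have l1: "(\<lambda>n. cos B * (cmod (x (f n r) - x (f n \<tau>)) * cmod (x (f n r') - x (f n \<tau>))))
     \<longlonglongrightarrow> cos B * (cmod (x r - x \<tau>) * cmod (x r' - x \<tau>))"
    by (intro tendsto_intros lim H)
  have l2: "(\<lambda>n. inner (x (f n r) - x (f n \<tau>)) (x (f n r') - x (f n \<tau>)))
     \<longlonglongrightarrow> inner (x r - x \<tau>) (x r' - x \<tau>)"
    by (intro tendsto_intros lim H)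
  show "cos B * (cmod (x r - x \<tau>) * cmod (x r' - x \<tau>)) \<le> inner (x r - x \<tau>) (x r' - x \<tau>)"
    by (rule LIMSEQ_le[OF l1 l2]) (intro exI[of _ 0] allI impI le)
qed

text \<open>An eel on a compact interval with \<lambda> written as \<open>cos \<alpha>\<close>;
  complex values make \<open>Arg\<close> and \<open>cis\<close> available. The velocity conditions
  stop before b, since a right derivative at b would look outside \<open>{a..b}\<close>.\<close>

locale plane_eel =
  fixes a b \<alpha> :: real and x v :: "real \<Rightarrow> complex"
  assumes cont: "continuous_on {a..b} x"
    and alpha: "0 < \<alpha>" "\<alpha> \<le> pi / 2"
    and deriv: "\<And>\<tau>. a \<le> \<tau> \<Longrightarrow> \<tau> < b \<Longrightarrow> (x has_vector_derivative v \<tau>) (at_right \<tau>)"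
    and v_nz: "\<And>\<tau>. a \<le> \<tau> \<Longrightarrow> \<tau> < b \<Longrightarrow> v \<tau> \<noteq> 0"
    and eel: "\<And>r \<tau>. a \<le> r \<Longrightarrow> r < \<tau> \<Longrightarrow> \<tau> < b \<Longrightarrow>
       inner (v \<tau>) (x r - x \<tau>) \<le> cos \<alpha> * (cmod (v \<tau>) * cmod (x r - x \<tau>))"
begin

section \<open>Velocity, displacement and cones\<close>

lemma right_quotient:
  assumes "a \<le> \<tau>" "\<tau> < b"
  shows "((\<lambda>s. (x s - x \<tau>) /\<^sub>R (s - \<tau>)) \<longlongrightarrow> v \<tau>) (at_right \<tau>)"
proof -
  have "((\<lambda>s. ((x s - x \<tau>) - (s - \<tau>) *\<^sub>R v \<tau>) /\<^sub>R norm (s - \<tau>)) \<longlongrightarrow> 0) (at_right \<tau>)"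
    using deriv[OF assms] unfolding has_vector_derivative_def has_derivative_at_within by blast
  moreover have "\<forall>\<^sub>F s in at_right \<tau>. ((x s - x \<tau>) - (s - \<tau>) *\<^sub>R v \<tau>) /\<^sub>R norm (s - \<tau>)
      = (x s - x \<tau>) /\<^sub>R (s - \<tau>) - v \<tau>"
    using eventually_at_right_less[of \<tau>]
    by eventually_elim (simp add: scaleR_diff_right)
  ultimately have "((\<lambda>s. (x s - x \<tau>) /\<^sub>R (s - \<tau>) - v \<tau>) \<longlongrightarrow> 0) (at_right \<tau>)"
    by (simp add: tendsto_cong)
  then show ?thesis by (rule LIM_zero_cancel)
qed

lemma tendsto_right:
  assumes "a \<le> \<tau>" "\<tau> < b"
  shows "(x \<longlongrightarrow> x \<tau>) (at_right \<tau>)"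
proof -
  have "(x \<longlongrightarrow> x \<tau>) (at \<tau> within {a..b})" using cont assms by (auto simp: continuous_on_def)
  then have "(x \<longlongrightarrow> x \<tau>) (at \<tau> within {\<tau>..b})" by (rule tendsto_within_subset) (use assms in auto)
  then show ?thesis using assms by (simp add: at_within_Icc_at_right)
qed

text \<open>The cone condition is positively homogeneous, so it may be tested on difference
  quotients; being strict, it persists near the limit.\<close>

lemma eventually_right_cone:
  assumes "a \<le> \<tau>" "\<tau> < b" "c * cmod (v \<tau>) < inner w (v \<tau>)"
  shows "\<forall>\<^sub>F s in at_right \<tau>. c * cmod (x s - x \<tau>) < inner w (x s - x \<tau>)"
proof -
  have "((\<lambda>s. inner w ((x s - x \<tau>) /\<^sub>R (s - \<tau>)) - c * cmod ((x s - x \<tau>) /\<^sub>R (s - \<tau>)))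
     \<longlongrightarrow> inner w (v \<tau>) - c * cmod (v \<tau>)) (at_right \<tau>)"
    by (intro tendsto_intros right_quotient assms)
  then have "\<forall>\<^sub>F s in at_right \<tau>. 0 < inner w ((x s - x \<tau>) /\<^sub>R (s - \<tau>)) - c * cmod ((x s - x \<tau>) /\<^sub>R (s - \<tau>))"
    by (rule order_tendstoD) (use assms in simp)
  then show ?thesis using eventually_at_right_less[of \<tau>]
    by eventually_elim (simp add: divide_simps mult.commute mult.left_commute)
qed

text \<open>Passage in the other direction: a closed cone containing all small displacements
  contains the velocity.\<close>

lemma limit_right_cone:
  assumes "a \<le> \<tau>" "\<tau> < b" "\<forall>\<^sub>F s in at_right \<tau>. c * cmod (x s - x \<tau>) \<le> inner w (x s - x \<tau>)"
  shows "c * cmod (v \<tau>) \<le> inner w (v \<tau>)"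
proof (rule tendsto_le)
  show "((\<lambda>s. inner w ((x s - x \<tau>) /\<^sub>R (s - \<tau>))) \<longlongrightarrow> inner w (v \<tau>)) (at_right \<tau>)"
    "((\<lambda>s. c * cmod ((x s - x \<tau>) /\<^sub>R (s - \<tau>))) \<longlongrightarrow> c * cmod (v \<tau>)) (at_right \<tau>)"
    by (intro tendsto_intros right_quotient assms)+
  show "\<forall>\<^sub>F s in at_right \<tau>. c * cmod ((x s - x \<tau>) /\<^sub>R (s - \<tau>)) \<le> inner w ((x s - x \<tau>) /\<^sub>R (s - \<tau>))"
    using assms(3) eventually_at_right_less[of \<tau>]
    by eventually_elim (simp add: divide_simps mult.commute mult.left_commute)
qed simp

lemma cos_alpha_less_1: "cos \<alpha> < 1"
  using cos_monotone_0_pi[of 0 \<alpha>] alpha by simp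

text \<open>The eel inequality in the form that the topological arguments use: no past point lies
  straight ahead, as \<open>cos \<alpha> < 1\<close>.\<close>

lemma no_positive_multiple:
  assumes "a \<le> r" "r < \<tau>" "\<tau> < b" "0 < k"
  shows "x r - x \<tau> \<noteq> of_real k * v \<tau>"
proof
  assume *: "x r - x \<tau> = of_real k * v \<tau>"
  have "inner (v \<tau>) (of_real k * v \<tau>) = k * (cmod (v \<tau>))\<^sup>2"
    by (simp add: dot_square_norm flip: scaleR_conv_of_real)
  then have "k * (cmod (v \<tau>))\<^sup>2 \<le> cos \<alpha> * (k * (cmod (v \<tau>))\<^sup>2)"
    using eel[OF assms(1-3)] assms(4) unfolding * by (simp add: norm_mult power2_eq_square mult_ac)
  moreover have "k * (cmod (v \<tau>))\<^sup>2 > 0" using assms v_nz[of \<tau>] by simp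
  ultimately show False
    using mult_strict_right_mono[OF cos_alpha_less_1, of "k * (cmod (v \<tau>))\<^sup>2"] by simp
qed

text \<open>A constant piece would have velocity zero. This yields times just before a return to p
  at which the curve is away from p.\<close>

lemma not_constant_left:
  assumes "a \<le> c" "c < \<tau>" "\<tau> \<le> b"
  shows "\<exists>s\<in>{c<..<\<tau>}. x s \<noteq> p"
proof (rule ccontr)
  assume "\<not> ?thesis"
  then have const: "\<And>s. c < s \<Longrightarrow> s < \<tau> \<Longrightarrow> x s = p" by auto
  define m where "m = (c + \<tau>) / 2"
  have m: "c < m" "m < \<tau>" using assms by (auto simp: m_def)
  have "((\<lambda>s. (x s - x m) /\<^sub>R (s - m)) \<longlongrightarrow> v m) (at_right m)"
    using m assms by (intro right_quotient) auto
  moreover have "\<forall>\<^sub>F s in at_right m. (x s - x m) /\<^sub>R (s - m) = 0"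
    using eventually_at_right_real[OF m(2)] by eventually_elim (use const m in auto)
  ultimately have "((\<lambda>s. 0) \<longlongrightarrow> v m) (at_right m)" by (rule Lim_transform_eventually)
  then have "v m = 0" by (simp add: tendsto_const_iff)
  then show False using v_nz[of m] m assms by simp
qed

text \<open>If the curve returned to a point \<open>p\<close> at time \<open>\<tau>\<close>, then earlier positions near \<open>p\<close> would have
  directions from \<open>p\<close> that accumulate; from a later one of them, \<open>p\<close> and a much more distant earlier
  one are seen in nearly opposite directions.\<close>

lemma spread_inj:
  assumes sp: "spread x B {s..t}" and st: "a \<le> s" "t \<le> b" and B: "0 \<le> B" "B < pi"
    and r: "s \<le> r" "r < \<tau>" "\<tau> \<le> t"
  shows "x r \<noteq> x \<tau>"
proof
  assume eq: "x r = x \<tau>"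
  have "\<exists>s'. max r (\<tau> - 1 / real (Suc n)) < s' \<and> s' < \<tau> \<and> x s' \<noteq> x \<tau>" for n
    using not_constant_left[of "max r (\<tau> - 1 / real (Suc n))" \<tau> "x \<tau>"] r st
    by (auto simp: le_max_iff_disj simp del: of_nat_Suc)
  then obtain y where y: "\<And>n. max r (\<tau> - 1 / real (Suc n)) < y n" "\<And>n. y n < \<tau>" "\<And>n. x (y n) \<noteq> x \<tau>"
    by metis
  have "seq_compact (sphere (0::complex) 1)" by (simp add: compact_imp_seq_compact)
  moreover have "sgn (x (y n) - x \<tau>) \<in> sphere 0 1" for n using y(3) by (simp add: norm_sgn)
  ultimately obtain d f where d: "d \<in> sphere (0::complex) 1" "strict_mono (f::nat\<Rightarrow>nat)"
      "((\<lambda>n. sgn (x (y n) - x \<tau>)) \<circ> f) \<longlonglongrightarrow> d"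
    by (elim seq_compactE[of _ "\<lambda>n. sgn (x (y n) - x \<tau>)"]) auto
  have ylim: "y \<longlonglongrightarrow> \<tau>"
  proof (rule tendsto_sandwich)
    show "\<forall>\<^sub>F n in sequentially. \<tau> - 1 / real (Suc n) \<le> y n" "\<forall>\<^sub>F n in sequentially. y n \<le> \<tau>"
      using y(1,2) by (simp_all add: less_imp_le)
    have "(\<lambda>n. \<tau> - 1 / real (Suc n)) \<longlonglongrightarrow> \<tau> - 0"
      by (intro tendsto_intros) (use LIMSEQ_inverse_real_of_nat in \<open>simp add: inverse_eq_divide\<close>)
    then show "(\<lambda>n. \<tau> - 1 / real (Suc n)) \<longlonglongrightarrow> \<tau>" by simp
  qed simp
  define z where "z n = x (y (f n)) - x \<tau>" for n
  have znz: "z n \<noteq> 0" for n using y(3) by (simp add: z_def)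
  have yf: "(\<lambda>n. y (f n)) \<longlonglongrightarrow> \<tau>" using LIMSEQ_subseq_LIMSEQ[OF ylim d(2)] by (simp add: o_def)
  have yin: "y n \<in> {a..b}" for n using y(1)[of n] y(2)[of n] r st by auto
  have "(\<lambda>n. x (y (f n))) \<longlonglongrightarrow> x \<tau>"
    by (rule continuous_on_tendsto_compose[OF cont yf]) (use yin r st in auto)
  then have zlim: "z \<longlonglongrightarrow> 0" unfolding z_def[abs_def] by (simp add: LIM_zero)
  have slim: "(\<lambda>n. sgn (z n)) \<longlonglongrightarrow> d" using d(3) by (simp add: z_def o_def)
  \<comment> \<open>Here k tends to infinity with j fixed. Since x r is the point p itself, it is
    seen from \<open>x (y (f k))\<close> in the direction - \<open>sgn (z k)\<close>. Letting j tend
    to infinity afterwards gives \<open>cos B \<le> -1\<close>.\<close>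
  have step: "cos B * cmod (z j) \<le> - inner d (z j)" for j
  proof (rule tendsto_le)
    show "(\<lambda>k. - inner (sgn (z k)) (z j - z k)) \<longlonglongrightarrow> - inner d (z j)"
      using tendsto_minus[OF tendsto_inner[OF slim tendsto_diff[OF tendsto_const zlim]]] by simp
    show "(\<lambda>k. cos B * cmod (z j - z k)) \<longlonglongrightarrow> cos B * cmod (z j)"
      using tendsto_mult[OF tendsto_const tendsto_norm[OF tendsto_diff[OF tendsto_const zlim]]] by fastforce
    have "\<forall>\<^sub>F k in sequentially. y (f j) < y (f k)"
      by (rule order_tendstoD[OF yf]) (use y(2) in auto)
    then show "\<forall>\<^sub>F k in sequentially. cos B * cmod (z j - z k) \<le> - inner (sgn (z k)) (z j - z k)"
    proof eventually_elim
      case (elim k)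
      have "cos B * (cmod (x r - x (y (f k))) * cmod (x (y (f j)) - x (y (f k))))
        \<le> inner (x r - x (y (f k))) (x (y (f j)) - x (y (f k)))"
        using y(1)[of "f k"] y(2)[of "f k"] y(1)[of "f j"] elim r by (intro spreadD[OF sp]) auto
      then have "cos B * (cmod (z k) * cmod (z j - z k)) \<le> inner (- z k) (z j - z k)"
        unfolding z_def eq by (simp add: norm_minus_commute)
      then show ?case
        using znz[of k] by (simp add: sgn_div_norm field_simps)
    qed
  qed simp
  have "cos B \<le> - inner d d"
  proof (rule tendsto_le)
    show "(\<lambda>k. - inner d (sgn (z k))) \<longlonglongrightarrow> - inner d d" by (intro tendsto_intros slim)
    show "(\<lambda>k. cos B) \<longlonglongrightarrow> cos B" by simp
    show "\<forall>\<^sub>F k in sequentially. cos B \<le> - inner d (sgn (z k))"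
      using step znz by (auto simp: sgn_div_norm field_simps)
  qed simp
  then have "cos B \<le> -1" using d(1) by (simp add: dot_square_norm)
  then show False using cos_monotone_0_pi[of B pi] B by simp
qed

text \<open>A weak bound below \<open>pi\<close> makes the arc of the curve between two past points appear as an arc of
  directions, which the velocity avoids. Hence the velocity is never between the two points and the
  barrier applies.\<close>

lemma spread_improve:
  assumes sp: "spread x B {s..t}" and st: "a \<le> s" "t \<le> b" and B: "0 \<le> B" "B < pi"
    and \<beta>: "pi - \<alpha> < \<beta>" "\<beta> < pi"
  shows "spread x \<beta> {s..t}"
proof -
  have nz: "x r \<noteq> x \<tau>" if "s \<le> r" "r < \<tau>" "\<tau> \<le> t" for r \<tau>
    using spread_inj[OF sp st B that] .
  have nonpos: "(x r - x \<tau>) / (x r' - x \<tau>) \<notin> \<real>\<^sub>\<le>\<^sub>0"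
    if "s \<le> r" "s \<le> r'" "r < \<tau>" "r' < \<tau>" "\<tau> \<le> t" for r r' \<tau>
    by (rule spread_not_nonpos[OF sp]) (use that B nz in auto)
  have key: "Arg ((x r2 - x \<tau>) / (x r1 - x \<tau>)) \<le> \<beta>"
    if H: "s \<le> r1" "s \<le> r2" "r1 < \<tau>" "r2 < \<tau>" "\<tau> \<le> t" "r1 \<noteq> r2" for r1 r2 \<tau>
  proof -
    define M where "M = max r1 r2"
    define g where "g \<sigma> = Arg ((x r2 - x \<sigma>) / (x r1 - x \<sigma>))" for \<sigma>
    have M: "s \<le> M" "M < \<tau>" "a \<le> M" "M < b" using H st by (auto simp: M_def)
    have "\<forall>\<^sub>F \<sigma> in at_right M. cos \<beta> * (cmod (x r2 - x \<sigma>) * cmod (x r1 - x \<sigma>)) < inner (x r2 - x \<sigma>) (x r1 - x \<sigma>)"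
    proof -
      \<comment> \<open>Just after M the younger point is seen along - v M, and the eel inequality
        at M puts the older one within pi - \<alpha> of that direction. So the barrier starts below
        \<beta>.\<close>
      define r where "r = min r1 r2"
      have r: "s \<le> r" "r < M" using H by (auto simp: r_def M_def)
      define w where "w = x r - x M"
      have w: "w \<noteq> 0" using nz[of r M] r M H by (simp add: w_def)
      have vM: "v M \<noteq> 0" using v_nz M by simp
      have "((\<lambda>\<sigma>. inner (x r - x \<sigma>) (- ((x \<sigma> - x M) /\<^sub>R (\<sigma> - M))) - cos \<beta> * (cmod (x r - x \<sigma>) * cmod (- ((x \<sigma> - x M) /\<^sub>R (\<sigma> - M)))))
          \<longlongrightarrow> inner w (- v M) - cos \<beta> * (cmod w * cmod (- v M))) (at_right M)"
        unfolding w_def by (intro tendsto_intros right_quotient tendsto_right M)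
      moreover have "0 < inner w (- v M) - cos \<beta> * (cmod w * cmod (- v M))"
      proof -
        have "inner w (v M) \<le> cos \<alpha> * (cmod w * cmod (v M))"
          using eel[of r M] r st M by (simp add: w_def inner_commute mult_ac)
        moreover have "cos \<beta> < - cos \<alpha>"
          using cos_monotone_0_pi[of "pi - \<alpha>" \<beta>] \<beta> alpha by simp
        then have "cos \<beta> * (cmod w * cmod (v M)) < - cos \<alpha> * (cmod w * cmod (v M))"
          using w vM by (intro mult_strict_right_mono) auto
        ultimately show ?thesis by simp
      qed
      ultimately have "\<forall>\<^sub>F \<sigma> in at_right M. 0 < inner (x r - x \<sigma>) (- ((x \<sigma> - x M) /\<^sub>R (\<sigma> - M))) - cos \<beta> * (cmod (x r - x \<sigma>) * cmod (- ((x \<sigma> - x M) /\<^sub>R (\<sigma> - M))))"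
        by (rule order_tendstoD)
      then show ?thesis using eventually_at_right_less[of M]
      proof eventually_elim
        case (elim \<sigma>)
        have e: "- ((x \<sigma> - x M) /\<^sub>R (\<sigma> - M)) = (x M - x \<sigma>) /\<^sub>R (\<sigma> - M)"
          by (simp add: scaleR_diff_right)
        have "0 < (inner (x r - x \<sigma>) (x M - x \<sigma>) - cos \<beta> * (cmod (x r - x \<sigma>) * cmod (x M - x \<sigma>))) / (\<sigma> - M)"
          using elim unfolding e by (simp add: diff_divide_distrib divide_inverse_commute mult_ac)
        then have "cos \<beta> * (cmod (x r - x \<sigma>) * cmod (x M - x \<sigma>)) < inner (x r - x \<sigma>) (x M - x \<sigma>)"
          using elim by (simp add: zero_less_divide_iff)
        then show ?case
          by (cases "r1 \<le> r2") (auto simp: r_def M_def mult_ac inner_commute min_def max_def)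
      qed
    qed
    then have "\<forall>\<^sub>F \<sigma> in at_right M. \<sigma> \<in> {M<..<\<tau>} \<and> cos \<beta> * (cmod (x r2 - x \<sigma>) * cmod (x r1 - x \<sigma>)) < inner (x r2 - x \<sigma>) (x r1 - x \<sigma>)"
      using eventually_at_right_real[OF M(2)] by eventually_elim auto
    then obtain t0 where t0: "M < t0" "t0 < \<tau>"
      "cos \<beta> * (cmod (x r2 - x t0) * cmod (x r1 - x t0)) < inner (x r2 - x t0) (x r1 - x t0)"
      using eventually_happens[of _ "at_right M"] by auto
    have rt0: "r1 < t0" "r2 < t0" using t0 by (auto simp: M_def)
    have "cos \<beta> < cos (g t0)"
      using t0 cos_Arg_divide[of "x r2 - x t0" "x r1 - x t0"] nz[of r1 t0] nz[of r2 t0] rt0 H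
      by (simp add: g_def pos_less_divide_eq)
    moreover have "\<bar>g t0\<bar> \<le> pi" "0 \<le> \<beta>"
      using \<beta> alpha Arg_bounded[of "(x r2 - x t0) / (x r1 - x t0)"] by (auto simp: g_def)
    ultimately have g0: "g t0 \<le> \<beta>"
      using cos_ge_imp_abs_le[of \<beta> "g t0"] \<beta> by simp
    have "g \<tau> \<le> \<beta>"
    proof (rule angle_barrier[where x = x and v = v and g = g and A = "x r1" and B = "x r2"
          and \<alpha> = \<alpha> and ?t0.0 = t0 and ?t1.0 = \<tau>])
      show cx: "continuous_on {t0..\<tau>} x"
        by (rule continuous_on_subset[OF cont]) (use t0 M H st in auto)
      show "continuous_on {t0..\<tau>} g"
        unfolding g_def using rt0 H nonpos
        by (intro continuous_intros cx) (auto simp: nz dest: nz[THEN not_sym])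
      show "\<exists>k>0. x r2 - x \<sigma> = of_real k * ((x r1 - x \<sigma>) * cis (g \<sigma>))" if "t0 \<le> \<sigma>" "\<sigma> \<le> \<tau>" for \<sigma>
        using polar_divide[of "x r1 - x \<sigma>" "x r2 - x \<sigma>"] nz[of r1 \<sigma>] nz[of r2 \<sigma>] rt0 that H
        unfolding g_def by (intro exI[of _ "cmod (x r2 - x \<sigma>) / cmod (x r1 - x \<sigma>)"]) auto
      fix \<sigma> \<theta> k assume o: "t0 \<le> \<sigma>" "\<sigma> < \<tau>" "g \<sigma> = \<beta>" "0 \<le> \<theta>" "\<theta> \<le> \<beta>" "0 < (k::real)"
      define \<phi> where "\<phi> \<rho> = Arg ((x \<rho> - x \<sigma>) / (x r1 - x \<sigma>))" for \<rho>
      have ends: "\<phi> r1 = 0" "\<phi> r2 = \<beta>"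
        using nz[of r1 \<sigma>] rt0 o H by (auto simp: \<phi>_def g_def)
      define l u where "l = min r1 r2" and "u = max r1 r2"
      have lu: "s \<le> l" "u < \<sigma>" "l \<le> u" using H rt0 o by (auto simp: l_def u_def)
      have "continuous_on {l..u} \<phi>"
        unfolding \<phi>_def using lu H o rt0 st nonpos
        by (intro continuous_intros continuous_on_subset[OF cont]) (auto simp: nz dest: nz[THEN not_sym])
      then have "connected (\<phi> ` {l..u})" by (intro connected_continuous_image) auto
      then have "\<theta> \<in> \<phi> ` {l..u}"
        by (rule connectedD_interval[of _ 0 \<beta>]) (use ends o in \<open>auto simp: l_def u_def image_iff intro: bexI[of _ r1] bexI[of _ r2]\<close>)
      then obtain \<rho> where \<rho>: "l \<le> \<rho>" "\<rho> \<le> u" "\<phi> \<rho> = \<theta>" by auto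
      show "v \<sigma> \<noteq> of_real k * ((x r1 - x \<sigma>) * cis \<theta>)"
      proof
        assume vk: "v \<sigma> = of_real k * ((x r1 - x \<sigma>) * cis \<theta>)"
        define k' where "k' = cmod (x \<rho> - x \<sigma>) / cmod (x r1 - x \<sigma>) / k"
        have "x \<rho> - x \<sigma> = of_real k' * v \<sigma>"
          using polar_divide[of "x r1 - x \<sigma>" "x \<rho> - x \<sigma>"] nz[of r1 \<sigma>] rt0 o H \<rho>
          by (simp add: vk k'_def \<phi>_def)
        moreover have "k' > 0" unfolding k'_def using nz[of r1 \<sigma>] nz[of \<rho> \<sigma>] \<rho> lu o H rt0 by auto
        ultimately show False using no_positive_multiple[of \<rho> \<sigma> k'] \<rho> lu o H st by auto
      qed
    next
      fix \<sigma> assume o: "t0 \<le> \<sigma>" "\<sigma> < \<tau>"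
      then have o': "a \<le> \<sigma>" "\<sigma> < b" "a \<le> r1" "a \<le> r2" "r1 < \<sigma>" "r2 < \<sigma>"
        using rt0 t0 M H st by auto
      show "(x has_vector_derivative v \<sigma>) (at_right \<sigma>)" "v \<sigma> \<noteq> 0" using o' deriv v_nz by auto
      show "inner (v \<sigma>) (x r1 - x \<sigma>) \<le> cos \<alpha> * (cmod (v \<sigma>) * cmod (x r1 - x \<sigma>))"
        "inner (v \<sigma>) (x r2 - x \<sigma>) \<le> cos \<alpha> * (cmod (v \<sigma>) * cmod (x r2 - x \<sigma>))"
        using o' eel by auto
    next
      fix \<sigma> assume "t0 \<le> \<sigma>" "\<sigma> \<le> \<tau>"
      then show "x r1 - x \<sigma> \<noteq> 0 \<and> x r2 - x \<sigma> \<noteq> 0"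
        using nz[of r1 \<sigma>] nz[of r2 \<sigma>] rt0 H by auto
    qed (use alpha \<beta> g0 t0 in auto)
    then show ?thesis by (simp add: g_def)
  qed
  show ?thesis unfolding spread_def
  proof (intro ballI impI)
    fix r r' \<tau> assume H: "r \<in> {s..t}" "r' \<in> {s..t}" "\<tau> \<in> {s..t}" "r \<le> \<tau>" "r' \<le> \<tau>"
    show "cos \<beta> * (cmod (x r - x \<tau>) * cmod (x r' - x \<tau>)) \<le> inner (x r - x \<tau>) (x r' - x \<tau>)"
    proof (cases "r = \<tau> \<or> r' = \<tau> \<or> r = r'")
      case True
      then show ?thesis using cos_le_inner_self by auto
    next
      case False
      define z where "z = (x r - x \<tau>) / (x r' - x \<tau>)"
      have n: "x r \<noteq> x \<tau>" "x r' \<noteq> x \<tau>" using nz H False by auto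
      have "Arg z \<le> \<beta>" using key[of r' r \<tau>] H False by (simp add: z_def)
      moreover have "Arg (inverse z) \<le> \<beta>" using key[of r r' \<tau>] H False by (simp add: z_def)
      \<comment> \<open>Inversion flips the sign of \<open>Arg\<close> off the reals; on the reals
        \<open>Arg\<close> is 0 or pi, so - \<open>Arg z\<close> is not positive.\<close>
      moreover have "- Arg z \<le> Arg (inverse z) \<or> - Arg z \<le> 0"
        by (auto simp: Arg_inverse Arg_real)
      ultimately have "\<bar>Arg z\<bar> \<le> \<beta>" using \<beta> alpha by auto
      then have "cos \<beta> \<le> cos (Arg z)"
        using \<beta> cos_monotone_0_pi_le[of "\<bar>Arg z\<bar>" \<beta>] by simp
      then show ?thesis
        using cos_Arg_divide[of "x r - x \<tau>" "x r' - x \<tau>"] n by (simp add: z_def pos_le_divide_eq)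
    qed
  qed
qed

end

section \<open>Gluing across a closed set of times with a common cone\<close>

context plane_eel begin

text \<open>After a time \<open>m \<in> P\<close> the curve stays in a thin cone around the direction \<open>-1\<close>, so all later
  views of the past avoid a sector around that direction and \<open>Arg\<close> is a continuous angle there.
  It is measured consistently for all past points, hence the velocity, which the connected set of past
  directions avoids, is never between two of them.\<close>

lemma spread_of_gaps:
  assumes st: "a \<le> s" "s \<le> t" "t \<le> b"
    and P: "closed P" "P \<subseteq> {s..t}"
    and cone: "\<And>m \<tau>. m \<in> P \<Longrightarrow> m < \<tau> \<Longrightarrow> \<tau> \<le> t \<Longrightarrow>
      x m \<noteq> x \<tau> \<and> cos (\<alpha> / 8) * cmod (x m - x \<tau>) \<le> Re (x m - x \<tau>)"
    and gaps: "\<And>c d. s \<le> c \<Longrightarrow> c < d \<Longrightarrow> d \<le> t \<Longrightarrow> P \<inter> {c<..<d} = {} \<Longrightarrow> spread x (pi - \<alpha> / 2) {c..d}"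
  shows "spread x (pi - \<alpha> / 2) {s..t}"
proof -
  define \<beta> \<epsilon> where "\<beta> = pi - \<alpha> / 2" and "\<epsilon> = \<alpha> / 8"
  have \<beta>: "0 \<le> \<beta>" "\<beta> < pi" "pi - \<alpha> < \<beta>" "\<beta> + \<epsilon> < pi - \<epsilon>" and \<epsilon>: "0 < \<epsilon>"
    using alpha by (auto simp: \<beta>_def \<epsilon>_def)
  have gaps': "spread x \<beta> {c..d}" if "s \<le> c" "c \<le> d" "d \<le> t" "P \<inter> {c<..<d} = {}" for c d
  proof (cases "c = d")
    case True
    then show ?thesis by (auto simp: spread_def)
  next
    case False
    then show ?thesis using gaps[of c d] that by (simp add: \<beta>_def)
  qed
  note cone' = cone[folded \<epsilon>_def]
  show ?thesis unfolding \<beta>_def[symmetric]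
  proof (cases "P \<inter> {s<..<t} = {} \<or> P = {}")
    case True
    then show "spread x \<beta> {s..t}" using gaps'[of s t] st by auto
  next
    case False
    \<comment> \<open>No element of P precedes k0, so the past of k0 is a gap. After k0, the point x
      k0 is a reference seen within \<epsilon> of the positive real axis.\<close>
    define k0 where "k0 = Inf P"
    have bdd: "bdd_below P" "bdd_above P" using P(2) by (auto intro: bdd_below_mono bdd_above_mono)
    have k0P: "k0 \<in> P" unfolding k0_def using False bdd P by (intro closed_contains_Inf) auto
    have k0le: "k0 \<le> k" if "k \<in> P" for k unfolding k0_def using that bdd by (intro cInf_lower)
    have k0: "s \<le> k0" "k0 < t"
      using P(2) k0P False k0le by force+
    have sp0: "spread x \<beta> {s..k0}"
      using k0 k0le by (intro gaps') force+
    \<comment> \<open>In the limit the cone puts - v m within \<epsilon> of the axis, and the eel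
      inequality puts every earlier point within pi - \<alpha> of - v m.\<close>
    have eelP: "cos (pi - \<alpha> + \<epsilon>) * cmod (x r - x m) \<le> Re (x r - x m)"
      if "m \<in> P" "m < t" "s \<le> r" "r < m" for r m
    proof -
      have m: "a \<le> m" "m < b" "a \<le> r" using that st P by auto
      have "\<forall>\<^sub>F \<sigma> in at_right m. cos \<epsilon> * cmod (x \<sigma> - x m) \<le> inner (-1) (x \<sigma> - x m)"
        using eventually_at_right_real[OF \<open>m < t\<close>]
      proof eventually_elim
        case (elim \<sigma>)
        then show ?case using cone'[OF \<open>m \<in> P\<close>, of \<sigma>] by (simp add: norm_minus_commute inner_complex_def)
      qed
      from limit_right_cone[OF m(1,2) this] have vm: "cos \<epsilon> * cmod (- v m) \<le> Re (- v m)"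
        by (simp add: inner_complex_def)
      have "cos (pi - \<alpha>) * (cmod (x r - x m) * cmod (- v m)) \<le> inner (x r - x m) (- v m)"
        using eel[of r m] m that by (simp add: inner_commute mult_ac)
      then show ?thesis
        using vm v_nz[of m] m alpha \<epsilon> by (intro Re_ge_cos_triangle[of "- v m"]) (auto simp: \<epsilon>_def)
    qed
    \<comment> \<open>The view of x r from x \<tau> is its view from x m plus the view of x m. The
      thin cone dominates because \<epsilon> < \<alpha> - \<epsilon>.\<close>
    have before: "x r \<noteq> x \<tau> \<and> cos (pi - \<alpha> + \<epsilon>) * cmod (x r - x \<tau>) \<le> Re (x r - x \<tau>)"
      if "m \<in> P" "s \<le> r" "r < m" "m < \<tau>" "\<tau> \<le> t" for r m \<tau>
    proof -
      have c: "- cos (\<alpha> - \<epsilon>) = cos (pi - \<alpha> + \<epsilon>)" 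
        by (simp add: cos_diff cos_add)
      have ce: "cos (\<alpha> - \<epsilon>) < cos \<epsilon>" "0 \<le> cos (\<alpha> - \<epsilon>)"
        using alpha by (auto simp: \<epsilon>_def intro!: cos_monotone_0_pi cos_ge_zero)
      note R = Re_ge_cos_add[of "cos (\<alpha> - \<epsilon>)" "x r - x m" "cos \<epsilon>" "x m - x \<tau>", unfolded c]
      show ?thesis
        using R eelP[of m r] cone'[of m \<tau>] ce that by auto
    qed
    have cos_mono: "cos (\<beta> + \<epsilon>) \<le> cos (pi - \<alpha> + \<epsilon>)" "cos (\<beta> + \<epsilon>) \<le> cos \<epsilon>"
      using alpha by (intro cos_monotone_0_pi_le; simp add: \<epsilon>_def \<beta>_def)+
    have sector: "x r \<noteq> x \<tau> \<and> cos (\<beta> + \<epsilon>) * cmod (x r - x \<tau>) \<le> Re (x r - x \<tau>)"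
      if "k0 \<le> \<tau>" "\<tau> \<le> t" "s \<le> r" "r < \<tau>" for r \<tau>
    proof -
      have w: "cos (\<beta> + \<epsilon>) * cmod z \<le> Re z" if "c * cmod z \<le> Re z" "cos (\<beta> + \<epsilon>) \<le> c" for c z
        using that(1) mult_right_mono[OF that(2), of "cmod z"] by simp
      note H = that
      \<comment> \<open>Either a time of P separates r from \<tau> or equals r, or \<tau> is k0, or
        r and \<tau> lie in one gap. In the last case the latest time k of P before r gives the
        reference: \<beta> from the spread on the gap and \<epsilon> from the cone at k.\<close>
      consider (A) k where "k \<in> P" "r \<le> k" "k < \<tau>" | (B) "\<tau> = k0" | (C) "k0 < \<tau>" "\<And>k. k \<in> P \<Longrightarrow> r \<le> k \<Longrightarrow> k \<ge> \<tau>"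
        by (metis H(1) linorder_not_le order_le_less)
      then show ?thesis
      proof cases
        case A
        show ?thesis
        proof (cases "r = k")
          case True
          then show ?thesis using cone'[of k \<tau>] A that w[OF _ cos_mono(2)] by blast
        next
          case False
          then have "r < k" using A by simp
          then show ?thesis using before[of k r \<tau>] A that w[OF _ cos_mono(1)] by blast
        qed
      next
        case B
        have "x r \<noteq> x \<tau>"
          by (rule spread_inj[OF sp0]) (use B that k0 st \<beta> in auto)
        then show ?thesis using eelP[of k0 r] k0P k0 B that w[OF _ cos_mono(1)] by blast
      next
        case C
        then have "k0 < r" using k0P by force
        define k where "k = Sup (P \<inter> {k0..r})"
        have bd: "bdd_above (P \<inter> {k0..r})" by auto
        have "closed (P \<inter> {k0..r})" "P \<inter> {k0..r} \<noteq> {}" using P k0P \<open>k0 < r\<close> by auto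
        then have kP: "k \<in> P \<inter> {k0..r}"
          unfolding k_def using bd by (intro closed_contains_Sup)
        have kup: "k' \<le> k" if "k' \<in> P \<inter> {k0..r}" for k'
          unfolding k_def using bd that by (intro cSup_upper)
        have "k < r" using kP C(2)[of r] that by (cases "k = r") auto
        have "P \<inter> {k<..<\<tau>} = {}"
        proof (rule ccontr)
          assume "P \<inter> {k<..<\<tau>} \<noteq> {}"
          then obtain k' where "k' \<in> P" "k < k'" "k' < \<tau>" by auto
          then show False using kup[of k'] C(2)[of k'] k0le[of k'] by (cases "k' \<le> r") auto
        qed
        then have sp: "spread x \<beta> {k..\<tau>}" using kP k0 that by (intro gaps') auto
        have "x r \<noteq> x \<tau>"
          by (rule spread_inj[OF sp]) (use kP k0 that \<open>k < r\<close> st \<beta> in auto)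
        moreover have "cos (\<beta> + \<epsilon>) * cmod (x r - x \<tau>) \<le> Re (x r - x \<tau>)"
          by (rule Re_ge_cos_triangle[of "x k - x \<tau>"])
            (use cone'[of k \<tau>] spreadD[OF sp, of r k \<tau>] kP \<open>k < r\<close> that \<beta> \<epsilon> in auto)
        ultimately show ?thesis ..
      qed
    qed
    define \<phi> where "\<phi> r \<tau> = Arg (x r - x \<tau>)" for r \<tau>
    have \<phi>b: "\<bar>\<phi> r \<tau>\<bar> \<le> \<beta> + \<epsilon>" if "k0 \<le> \<tau>" "\<tau> \<le> t" "s \<le> r" "r < \<tau>" for r \<tau>
      using sector[OF that] abs_Arg_le_iff[of "x r - x \<tau>" "\<beta> + \<epsilon>"] \<beta> \<epsilon> by (auto simp: \<phi>_def)
    have nonpos: "x r - x \<tau> \<notin> \<real>\<^sub>\<le>\<^sub>0" if "k0 \<le> \<tau>" "\<tau> \<le> t" "s \<le> r" "r < \<tau>" for r \<tau>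
      by (rule not_nonpos_Reals_if_abs_Arg_less)
         (use sector[OF that] \<phi>b[OF that] \<beta> \<epsilon> in \<open>auto simp: \<phi>_def\<close>)
    have ivt: "\<exists>\<rho>. s \<le> \<rho> \<and> \<rho> < \<tau> \<and> \<phi> \<rho> \<tau> = y"
      if H: "k0 \<le> \<tau>" "\<tau> \<le> t" "s \<le> r1" "r1 < \<tau>" "s \<le> r2" "r2 < \<tau>" "\<phi> r1 \<tau> \<le> y" "y \<le> \<phi> r2 \<tau>" for r1 r2 \<tau> y
    proof -
      have "continuous_on {s..<\<tau>} (\<lambda>\<rho>. \<phi> \<rho> \<tau>)"
        unfolding \<phi>_def using H st nonpos
        by (intro continuous_intros continuous_on_subset[OF cont]) auto
      then have "connected ((\<lambda>\<rho>. \<phi> \<rho> \<tau>) ` {s..<\<tau>})" by (intro connected_continuous_image) auto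
      then have "y \<in> (\<lambda>\<rho>. \<phi> \<rho> \<tau>) ` {s..<\<tau>}"
        by (rule connectedD_interval[of _ "\<phi> r1 \<tau>" "\<phi> r2 \<tau>"]) (use H in auto)
      then show ?thesis by auto
    qed
    have pol: "x r - x \<tau> = of_real (cmod (x r - x \<tau>)) * cis (\<phi> r \<tau>)" for r \<tau>
      unfolding \<phi>_def by (rule polar)
    have nomult: "v \<tau> \<noteq> of_real k * cis (\<phi> \<rho> \<tau>)"
      if "k0 \<le> \<tau>" "\<tau> < t" "s \<le> \<rho>" "\<rho> < \<tau>" "0 < k" for \<rho> \<tau> k
    proof
      assume v: "v \<tau> = of_real k * cis (\<phi> \<rho> \<tau>)"
      have "x \<rho> - x \<tau> = of_real (cmod (x \<rho> - x \<tau>) / k) * v \<tau>"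
        using pol[of \<rho> \<tau>] \<open>0 < k\<close> unfolding v by simp
      moreover have "cmod (x \<rho> - x \<tau>) / k > 0" using sector[of \<tau> \<rho>] that by simp
      ultimately show False using no_positive_multiple[of \<rho> \<tau> "cmod (x \<rho> - x \<tau>) / k"] that st by auto
    qed
    have inner_eq: "inner (x r - x \<tau>) (x r' - x \<tau>) = cmod (x r - x \<tau>) * cmod (x r' - x \<tau>) * cos (\<phi> r \<tau> - \<phi> r' \<tau>)" for r r' \<tau>
      unfolding \<phi>_def by (rule inner_Arg_diff)
    have \<phi>P: "\<bar>\<phi> m \<tau>\<bar> \<le> \<epsilon>" if "m \<in> P" "m < \<tau>" "\<tau> \<le> t" for m \<tau>
      using cone'[of m \<tau>] that abs_Arg_le_iff[of "x m - x \<tau>" \<epsilon>] \<epsilon> \<beta> by (auto simp: \<phi>_def)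
    have \<phi>right: "((\<lambda>\<sigma>. \<phi> r \<sigma>) \<longlongrightarrow> \<phi> r \<tau>) (at_right \<tau>)"
      if "k0 \<le> \<tau>" "\<tau> < t" "s \<le> r" "r < \<tau>" for r \<tau>
      unfolding \<phi>_def using that st nonpos[of \<tau> r] by (intro tendsto_intros tendsto_right) auto
    have bar: "\<phi> r2 \<tau> - \<phi> r1 \<tau> \<le> \<beta>"
      if H: "s \<le> r1" "s \<le> r2" "r1 < t0" "r2 < t0" "k0 \<le> t0" "t0 \<le> \<tau>" "\<tau> \<le> t"
        and start: "\<phi> r2 t0 - \<phi> r1 t0 \<le> \<beta>" for r1 r2 t0 \<tau>
    proof (rule angle_barrier[where x = x and v = v and g = "\<lambda>\<sigma>. \<phi> r2 \<sigma> - \<phi> r1 \<sigma>" and A = "x r1" and B = "x r2"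
          and \<alpha> = \<alpha> and ?t0.0 = t0 and ?t1.0 = \<tau>])
      show cx: "continuous_on {t0..\<tau>} x"
        by (rule continuous_on_subset[OF cont]) (use H k0 st in auto)
      show "continuous_on {t0..\<tau>} (\<lambda>\<sigma>. \<phi> r2 \<sigma> - \<phi> r1 \<sigma>)"
        unfolding \<phi>_def using H nonpos by (intro continuous_intros cx) auto
    next
      fix \<sigma> assume o: "t0 \<le> \<sigma>" "\<sigma> \<le> \<tau>"
      show nz: "x r1 - x \<sigma> \<noteq> 0 \<and> x r2 - x \<sigma> \<noteq> 0"
        using sector[of \<sigma> r1] sector[of \<sigma> r2] H o by auto
      have "x r2 - x \<sigma> = of_real (cmod (x r2 - x \<sigma>) / cmod (x r1 - x \<sigma>)) * ((of_real (cmod (x r1 - x \<sigma>)) * cis (\<phi> r1 \<sigma>)) * cis (\<phi> r2 \<sigma> - \<phi> r1 \<sigma>))"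
        using nz pol[of r2 \<sigma>] by (simp add: mult.assoc cis_mult)
      then have "x r2 - x \<sigma> = of_real (cmod (x r2 - x \<sigma>) / cmod (x r1 - x \<sigma>)) * ((x r1 - x \<sigma>) * cis (\<phi> r2 \<sigma> - \<phi> r1 \<sigma>))"
        using pol[of r1 \<sigma>] by metis
      moreover have "cmod (x r2 - x \<sigma>) / cmod (x r1 - x \<sigma>) > 0" using nz by simp
      ultimately show "\<exists>k>0. x r2 - x \<sigma> = of_real k * ((x r1 - x \<sigma>) * cis (\<phi> r2 \<sigma> - \<phi> r1 \<sigma>))"
        by blast
    next
      fix \<sigma> \<theta> k assume o: "t0 \<le> \<sigma>" "\<sigma> < \<tau>" "\<phi> r2 \<sigma> - \<phi> r1 \<sigma> = \<beta>" "0 \<le> \<theta>" "\<theta> \<le> \<beta>" "0 < (k::real)"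
      then obtain \<rho> where \<rho>: "s \<le> \<rho>" "\<rho> < \<sigma>" "\<phi> \<rho> \<sigma> = \<phi> r1 \<sigma> + \<theta>"
        using ivt[of \<sigma> r1 r2 "\<phi> r1 \<sigma> + \<theta>"] H by auto
      show "v \<sigma> \<noteq> of_real k * ((x r1 - x \<sigma>) * cis \<theta>)"
      proof
        assume "v \<sigma> = of_real k * ((x r1 - x \<sigma>) * cis \<theta>)"
        also have "\<dots> = of_real k * ((of_real (cmod (x r1 - x \<sigma>)) * cis (\<phi> r1 \<sigma>)) * cis \<theta>)"
          using pol[of r1 \<sigma>] by metis
        also have "\<dots> = of_real (k * cmod (x r1 - x \<sigma>)) * cis (\<phi> \<rho> \<sigma>)"
          by (simp add: \<rho> mult.assoc cis_mult)
        finally show False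
          using nomult[of \<sigma> \<rho> "k * cmod (x r1 - x \<sigma>)"] \<rho> o H sector[of \<sigma> r1] by auto
      qed
    next
      fix \<sigma> assume o: "t0 \<le> \<sigma>" "\<sigma> < \<tau>"
      then have o': "a \<le> \<sigma>" "\<sigma> < b" "a \<le> r1" "a \<le> r2" "r1 < \<sigma>" "r2 < \<sigma>"
        using H k0 st by auto
      show "(x has_vector_derivative v \<sigma>) (at_right \<sigma>)" "v \<sigma> \<noteq> 0" using o' deriv v_nz by auto
      show "inner (v \<sigma>) (x r1 - x \<sigma>) \<le> cos \<alpha> * (cmod (v \<sigma>) * cmod (x r1 - x \<sigma>))"
        "inner (v \<sigma>) (x r2 - x \<sigma>) \<le> cos \<alpha> * (cmod (v \<sigma>) * cmod (x r2 - x \<sigma>))"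
        using o' eel by auto
    qed (use alpha \<beta> start H in auto)
    \<comment> \<open>\<open>spread\<close> controls the cosine of the difference only. A difference
      beyond pi would, by connectedness of the past, be accompanied by a difference of exactly
      pi.\<close>
    have inside: "\<phi> r2 k0 - \<phi> r1 k0 \<le> \<beta>" if H: "s \<le> r1" "s \<le> r2" "r1 < k0" "r2 < k0" for r1 r2
    proof (rule ccontr)
      assume n: "\<not> ?thesis"
      define \<beta>' where "\<beta>' = pi - 3 * \<alpha> / 4"
      have sp: "spread x \<beta>' {s..k0}"
        by (rule spread_improve[OF sp0]) (use st k0 \<beta> alpha in \<open>auto simp: \<beta>'_def\<close>)
      have c: "cos \<beta>' \<le> cos (\<phi> r k0 - \<phi> r' k0)" if "s \<le> r" "s \<le> r'" "r < k0" "r' < k0" for r r'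
      proof -
        have pos: "cmod (x r - x k0) * cmod (x r' - x k0) > 0"
          using sector[of k0 r] sector[of k0 r'] that k0 by auto
        have "cos \<beta>' * (cmod (x r - x k0) * cmod (x r' - x k0))
            \<le> cos (\<phi> r k0 - \<phi> r' k0) * (cmod (x r - x k0) * cmod (x r' - x k0))"
          using spreadD[OF sp, of r r' k0] that k0 unfolding inner_eq by (simp add: mult.commute)
        then show ?thesis using mult_le_cancel_right_pos[OF pos] by blast
      qed
      have \<beta>': "0 \<le> \<beta>'" "\<beta>' < \<beta>" using alpha by (auto simp: \<beta>'_def \<beta>_def)
      show False
      proof (cases "\<phi> r2 k0 - \<phi> r1 k0 \<le> pi")
        case True
        then have "cos (\<phi> r2 k0 - \<phi> r1 k0) < cos \<beta>'" using n \<beta>' by (intro cos_monotone_0_pi) auto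
        then show False using c[of r2 r1] H by auto
      next
        case False
        then obtain \<rho> where \<rho>: "s \<le> \<rho>" "\<rho> < k0" "\<phi> \<rho> k0 = \<phi> r1 k0 + pi"
          using ivt[of k0 r1 r2 "\<phi> r1 k0 + pi"] H k0 by auto
        then have "cos \<beta>' \<le> -1" using c[of \<rho> r1] H by auto
        then show False using cos_monotone_0_pi[of \<beta>' pi] \<beta>' \<beta> by auto
      qed
    qed
    \<comment> \<open>The starting value for the barrier right after M. The direction to x M
      converges to that of - v M because the sector keeps both off the branch cut.\<close>
    have start: "\<forall>\<^sub>F \<sigma> in at_right M. \<bar>\<phi> M \<sigma> - \<phi> r \<sigma>\<bar> < \<beta>"
      if H: "s \<le> r" "r < M" "k0 < M" "M < t" for r M
    proof -
      have M: "a \<le> M" "M < b" "v M \<noteq> 0" using H k0 st v_nz[of M] by auto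
      define \<psi> where "\<psi> = Arg (- v M)"
      have "\<forall>\<^sub>F \<sigma> in at_right M. cos (\<beta> + \<epsilon>) * cmod (x \<sigma> - x M) \<le> inner (-1) (x \<sigma> - x M)"
        using eventually_at_right_real[OF \<open>M < t\<close>]
      proof eventually_elim
        case (elim \<sigma>)
        then show ?case using sector[of \<sigma> M] H k0 by (simp add: norm_minus_commute inner_complex_def)
      qed
      from limit_right_cone[OF M(1,2) this] have "cos (\<beta> + \<epsilon>) * cmod (- v M) \<le> Re (- v M)"
        by (simp add: inner_complex_def)
      then have \<psi>b: "\<bar>\<psi>\<bar> \<le> \<beta> + \<epsilon>"
        using abs_Arg_le_iff[of "- v M" "\<beta> + \<epsilon>"] M \<beta> \<epsilon> by (auto simp: \<psi>_def)
      have "((\<lambda>\<sigma>. Arg (- ((x \<sigma> - x M) /\<^sub>R (\<sigma> - M)))) \<longlongrightarrow> \<psi>) (at_right M)"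
        unfolding \<psi>_def using M \<psi>b \<beta> \<epsilon>
        by (intro tendsto_intros right_quotient not_nonpos_Reals_if_abs_Arg_less) (auto simp: \<psi>_def)
      moreover have "\<forall>\<^sub>F \<sigma> in at_right M. Arg (- ((x \<sigma> - x M) /\<^sub>R (\<sigma> - M))) = \<phi> M \<sigma>"
        using eventually_at_right_less[of M]
      proof eventually_elim
        case (elim \<sigma>)
        have "- ((x \<sigma> - x M) /\<^sub>R (\<sigma> - M)) = (x M - x \<sigma>) / of_real (\<sigma> - M)"
          by (simp add: scaleR_conv_of_real divide_inverse_commute algebra_simps)
        then show ?case using elim by (simp add: \<phi>_def del: of_real_diff)
      qed
      ultimately have l1: "(\<phi> M \<longlongrightarrow> \<psi>) (at_right M)" by (rule Lim_transform_eventually)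
      have l2: "(\<phi> r \<longlongrightarrow> \<phi> r M) (at_right M)" using H by (intro \<phi>right) auto
      define d where "d = \<psi> - \<phi> r M"
      have rM: "x r - x M \<noteq> 0" using sector[of M r] H by auto
      have "- cos \<alpha> * (cmod (v M) * cmod (x r - x M)) \<le> inner (- v M) (x r - x M)"
        using eel[of r M] M H st by simp
      also have "inner (- v M) (x r - x M) = cmod (v M) * cmod (x r - x M) * cos d"
        unfolding inner_Arg_diff by (simp add: d_def \<psi>_def \<phi>_def)
      finally have "- cos \<alpha> * (cmod (v M) * cmod (x r - x M)) \<le> cos d * (cmod (v M) * cmod (x r - x M))"
        by (simp add: mult.commute)
      moreover have "cmod (v M) * cmod (x r - x M) > 0" using M rM by simp
      ultimately have "- cos \<alpha> \<le> cos d" using mult_le_cancel_right_pos by blast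
      then have cd: "cos (pi - \<alpha>) \<le> cos d" by simp
      have vM: "v M = of_real (cmod (v M)) * cis (\<psi> - pi)" "v M = of_real (cmod (v M)) * cis (\<psi> + pi)"
        using polar[of "- v M"]
        by (simp_all add: \<psi>_def cis_divide[symmetric] cis_mult[symmetric] minus_equation_iff[of "v M"])
      \<comment> \<open>The eel inequality bounds d modulo 2 pi. If \<bar>d\<bar> exceeded pi, the
        direction \<psi> - pi or \<psi> + pi of v M would lie between those to x r and to x k0, and
        some past point would be straight ahead.\<close>
      have "\<bar>d\<bar> < \<beta>"
      proof (rule ccontr)
        assume n: "\<not> \<bar>d\<bar> < \<beta>"
        have "\<bar>d\<bar> > pi"
        proof (rule ccontr)
          assume "\<not> \<bar>d\<bar> > pi"
          then have "cos \<bar>d\<bar> < cos (pi - \<alpha>)" using n \<beta> alpha by (intro cos_monotone_0_pi) auto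
          then show False using cd by simp
        qed
        then consider "d > pi" | "d < -pi" by linarith
        moreover have "\<psi> - pi \<le> \<phi> k0 M" "\<phi> k0 M \<le> \<psi> + pi"
          using \<phi>P[of k0 M] H k0P \<psi>b \<beta> by auto
        ultimately show False
        proof cases
          case 1
          then obtain \<rho> where "s \<le> \<rho>" "\<rho> < M" "\<phi> \<rho> M = \<psi> - pi"
            using ivt[of M r k0 "\<psi> - pi"] \<open>\<psi> - pi \<le> \<phi> k0 M\<close> \<open>\<phi> k0 M \<le> \<psi> + pi\<close> H k0 by (auto simp: d_def)
          then show False using nomult[of M \<rho> "cmod (v M)"] vM(1) M H by auto
        next
          case 2
          then obtain \<rho> where "s \<le> \<rho>" "\<rho> < M" "\<phi> \<rho> M = \<psi> + pi"
            using ivt[of M k0 r "\<psi> + pi"] \<open>\<psi> - pi \<le> \<phi> k0 M\<close> \<open>\<phi> k0 M \<le> \<psi> + pi\<close> H k0 by (auto simp: d_def)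
          then show False using nomult[of M \<rho> "cmod (v M)"] vM(2) M H by auto
        qed
      qed
      moreover have "((\<lambda>\<sigma>. \<bar>\<phi> M \<sigma> - \<phi> r \<sigma>\<bar>) \<longlongrightarrow> \<bar>d\<bar>) (at_right M)"
        unfolding d_def by (intro tendsto_intros l1 l2)
      ultimately show ?thesis by (rule order_tendstoD(2)[rotated])
    qed
    have key: "\<phi> r2 \<tau> - \<phi> r1 \<tau> \<le> \<beta>"
      if H: "s \<le> r1" "s \<le> r2" "r1 < \<tau>" "r2 < \<tau>" "r1 \<noteq> r2" "k0 < \<tau>" "\<tau> \<le> t" for r1 r2 \<tau>
    proof -
      define M r where "M = max r1 r2" and "r = min r1 r2"
      have Mr: "s \<le> r" "r < M" "M < \<tau>" using H by (auto simp: M_def r_def)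
      have sym: "(r1 = r \<and> r2 = M) \<or> (r1 = M \<and> r2 = r)" by (auto simp: M_def r_def)
      consider "M < k0" | "M = k0" | "k0 < M" by linarith
      then show ?thesis
      proof cases
        case 1
        then have "r1 < k0" "r2 < k0" by (auto simp: M_def)
        then show ?thesis using bar[of r1 r2 k0 \<tau>] inside[of r1 r2] H by auto
      next
        \<comment> \<open>The two bounds add up to \<open>pi - \<alpha> + 2 * \<epsilon>\<close>,
          which is below \<beta>.\<close>
        case 2
        have "\<bar>\<phi> M \<tau>\<bar> \<le> \<epsilon>" using \<phi>P[of k0 \<tau>] 2 k0P H by simp
        moreover have "\<bar>\<phi> r \<tau>\<bar> \<le> pi - \<alpha> + \<epsilon>"
          using before[of k0 r \<tau>] abs_Arg_le_iff[of "x r - x \<tau>" "pi - \<alpha> + \<epsilon>"] 2 k0P H Mr alpha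
          by (auto simp: \<phi>_def \<epsilon>_def)
        ultimately show ?thesis using sym \<epsilon> alpha by (auto simp: \<beta>_def \<epsilon>_def)
      next
        case 3
        have "\<forall>\<^sub>F \<sigma> in at_right M. \<sigma> \<in> {M<..<\<tau>} \<and> \<bar>\<phi> M \<sigma> - \<phi> r \<sigma>\<bar> < \<beta>"
          using Mr 3 H by (intro eventually_conj eventually_at_right_real start) auto
        then obtain t0 where t0: "M < t0" "t0 < \<tau>" "\<bar>\<phi> M t0 - \<phi> r t0\<bar> < \<beta>"
          using eventually_happens[of _ "at_right M"] by auto
        then show ?thesis using bar[of r1 r2 t0 \<tau>] sym Mr 3 H by auto
      qed
    qed
    show "spread x \<beta> {s..t}" unfolding spread_def
    proof (intro ballI impI)
      fix r r' \<tau> assume H: "r \<in> {s..t}" "r' \<in> {s..t}" "\<tau> \<in> {s..t}" "r \<le> \<tau>" "r' \<le> \<tau>"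
      consider "\<tau> \<le> k0" | "r = \<tau> \<or> r' = \<tau> \<or> r = r'" | "k0 < \<tau>" "r < \<tau>" "r' < \<tau>" "r \<noteq> r'" using H by force
      then show "cos \<beta> * (cmod (x r - x \<tau>) * cmod (x r' - x \<tau>)) \<le> inner (x r - x \<tau>) (x r' - x \<tau>)"
      proof cases
        case 1
        then show ?thesis using spreadD[OF sp0, of r r' \<tau>] H by auto
      next
        case 2
        then show ?thesis using cos_le_inner_self by auto
      next
        case 3
        then have "\<bar>\<phi> r \<tau> - \<phi> r' \<tau>\<bar> \<le> \<beta>" using key[of r r' \<tau>] key[of r' r \<tau>] H by auto
        then have "cos \<beta> \<le> cos (\<phi> r \<tau> - \<phi> r' \<tau>)"
          using \<beta> cos_monotone_0_pi_le[of "\<bar>\<phi> r \<tau> - \<phi> r' \<tau>\<bar>" \<beta>] by simp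
        then have "cos \<beta> * (cmod (x r - x \<tau>) * cmod (x r' - x \<tau>)) \<le> cos (\<phi> r \<tau> - \<phi> r' \<tau>) * (cmod (x r - x \<tau>) * cmod (x r' - x \<tau>))"
          by (intro mult_right_mono) auto
        then show ?thesis unfolding inner_eq by (simp add: mult.commute)
      qed
    qed
  qed
qed

end

section \<open>Local and global spread\<close>

lemma spread_rotate:
  assumes "cmod w = 1"
  shows "spread (\<lambda>\<tau>. w * x \<tau>) B S \<longleftrightarrow> spread x B S"
  unfolding spread_def using assms
  by (simp add: inner_complex_mult_left norm_mult flip: right_diff_distrib)

lemma plane_eel_rotate:
  assumes "plane_eel a b \<alpha> x v" "cmod w = 1"
  shows "plane_eel a b \<alpha> (\<lambda>\<tau>. w * x \<tau>) (\<lambda>\<tau>. w * v \<tau>)"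
proof -
  interpret plane_eel a b \<alpha> x v by fact
  have "w \<noteq> 0" using assms(2) by auto
  then show ?thesis
    using cont alpha deriv v_nz eel assms(2)
    by unfold_locales
      (auto intro!: continuous_intros has_vector_derivative_mult_right
        simp: inner_complex_mult_left norm_mult simp flip: right_diff_distrib)
qed

context plane_eel begin

text \<open>Multiplication by - \<open>cnj w\<close> is a rotation that turns the axis w of the
  forward cones into -1; then points of P are seen around the positive real axis.\<close>

lemma spread_of_gaps_direction:
  assumes st: "a \<le> s" "s \<le> t" "t \<le> b"
    and P: "closed P" "P \<subseteq> {s..t}" and w: "cmod w = 1"
    and cone: "\<And>m \<tau>. m \<in> P \<Longrightarrow> m < \<tau> \<Longrightarrow> \<tau> \<le> t \<Longrightarrow>
      x m \<noteq> x \<tau> \<and> cos (\<alpha> / 8) * cmod (x \<tau> - x m) \<le> inner w (x \<tau> - x m)"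
    and gaps: "\<And>c d. s \<le> c \<Longrightarrow> c < d \<Longrightarrow> d \<le> t \<Longrightarrow> P \<inter> {c<..<d} = {} \<Longrightarrow> spread x (pi - \<alpha> / 2) {c..d}"
  shows "spread x (pi - \<alpha> / 2) {s..t}"
proof -
  define u where "u = - cnj w"
  have u: "cmod u = 1" "u \<noteq> 0" using w by (auto simp: u_def)
  interpret rot: plane_eel a b \<alpha> "\<lambda>\<tau>. u * x \<tau>" "\<lambda>\<tau>. u * v \<tau>"
    by (rule plane_eel_rotate) (use plane_eel_axioms u in auto)
  have "spread (\<lambda>\<tau>. u * x \<tau>) (pi - \<alpha> / 2) {s..t}"
  proof (rule rot.spread_of_gaps[OF st P])
    fix m \<tau> assume H: "m \<in> P" "m < \<tau>" "\<tau> \<le> t"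
    have "Re (u * x m - u * x \<tau>) = inner w (x \<tau> - x m)"
      by (simp add: u_def inner_complex_def algebra_simps)
    moreover have "cmod (u * x m - u * x \<tau>) = cmod (x \<tau> - x m)"
      using u by (simp add: norm_mult norm_minus_commute flip: right_diff_distrib)
    ultimately show "u * x m \<noteq> u * x \<tau> \<and> cos (\<alpha> / 8) * cmod (u * x m - u * x \<tau>) \<le> Re (u * x m - u * x \<tau>)"
      using cone[OF H] u by simp
  qed (use gaps u in \<open>auto simp: spread_rotate\<close>)
  then show ?thesis using u by (simp add: spread_rotate)
qed

text \<open>Small spread extends to the supremum m of the good initial segments by closure. Beyond
  m, the nonzero velocity gives a thin cone after m, so the segments on both sides of m are glued
  with P = {m}.\<close>

lemma spread_local_to_global:
  assumes cd: "a \<le> c" "c \<le> d" "d \<le> b"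
    and loc: "\<And>\<tau>. c \<le> \<tau> \<Longrightarrow> \<tau> < d \<Longrightarrow> \<exists>e>\<tau>. e \<le> d \<and> spread x (pi - \<alpha> / 2) {\<tau>..e}"
  shows "spread x (pi - \<alpha> / 2) {c..d}"
proof -
  define T where "T = {m\<in>{c..d}. spread x (pi - \<alpha> / 2) {c..m}}"
  define m where "m = Sup T"
  have cT: "c \<in> T" using cd by (auto simp: T_def spread_def)
  have bdd: "bdd_above T" by (auto simp: T_def)
  have m: "c \<le> m" "m \<le> d"
    using cT bdd unfolding m_def by (auto intro!: cSup_upper cSup_least) (auto simp: T_def)
  have spm: "spread x (pi - \<alpha> / 2) {c..m}"
  proof (cases "c = m")
    case True
    then show ?thesis by (auto simp: spread_def)
  next
    case False
    show ?thesis
    proof (rule spread_closure)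
      fix c' d' assume H: "c < c'" "c' < d'" "d' < m"
      then obtain m' where "m' \<in> T" "d' < m'"
        using less_cSup_iff[of T d'] cT bdd by (auto simp: m_def)
      then show "spread x (pi - \<alpha> / 2) {c'..d'}"
        using H by (auto simp: T_def elim!: spread_subset)
    qed (use False m cd in \<open>auto intro: continuous_on_subset[OF cont]\<close>)
  qed
  have "m = d"
  proof (rule ccontr)
    assume "m \<noteq> d"
    then have "m < d" using m by simp
    obtain e where e: "m < e" "e \<le> d" "spread x (pi - \<alpha> / 2) {m..e}"
      using loc[of m] m \<open>m < d\<close> by auto
    have am: "a \<le> m" "m < b" using m cd \<open>m < d\<close> by auto
    define w where "w = sgn (v m)"
    have w: "cmod w = 1" using v_nz am by (simp add: w_def norm_sgn)
    have "inner w (v m) = cmod (v m)"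
      using v_nz[of m] am by (simp add: w_def sgn_div_norm dot_square_norm power2_eq_square)
    moreover have "cos (\<alpha> / 8) < 1" using alpha cos_monotone_0_pi[of 0 "\<alpha> / 8"] by simp
    ultimately have "cos (\<alpha> / 8) * cmod (v m) < inner w (v m)" using v_nz[of m] am by simp
    from eventually_right_cone[OF am this]
    obtain f where f: "m < f" "\<And>s. m < s \<Longrightarrow> s < f \<Longrightarrow> cos (\<alpha> / 8) * cmod (x s - x m) < inner w (x s - x m)"
      unfolding eventually_at_right_field by auto
    define e' where "e' = min e ((m + f) / 2)"
    have e': "m < e'" "e' \<le> e" "e' < f" using e f by (auto simp: e'_def min_def)
    have "spread x (pi - \<alpha> / 2) {c..e'}"
    proof (rule spread_of_gaps_direction[where P = "{m}" and w = w])
      fix k \<tau> assume "k \<in> {m}" "k < \<tau>" "\<tau> \<le> e'"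
      then show "x k \<noteq> x \<tau> \<and> cos (\<alpha> / 8) * cmod (x \<tau> - x k) \<le> inner w (x \<tau> - x k)"
        using f(2)[of \<tau>] e' by auto
    next
      fix c' d' assume H: "c \<le> c'" "c' < d'" "d' \<le> e'" "{m} \<inter> {c'<..<d'} = {}"
      then consider "d' \<le> m" | "m \<le> c'" by force
      then show "spread x (pi - \<alpha> / 2) {c'..d'}"
      proof cases
        case 1
        then show ?thesis using spm H by (auto elim!: spread_subset)
      next
        case 2
        then show ?thesis using e(3) H e' by (auto elim!: spread_subset)
      qed
    qed (use m e e' cd w in auto)
    then have "e' \<in> T" using m e' e by (auto simp: T_def)
    then have "e' \<le> m" unfolding m_def using bdd by (intro cSup_upper)
    then show False using e' by simp
  qed
  then show ?thesis using spm by simp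
qed

text \<open>A right derivative carries no uniformity. Baire's theorem on the closed set \<open>K\<close> of times without
  a neighbourhood of small spread yields a portion of \<open>K\<close> on which the cones after each time have a
  common axis and a common size, and there the gaps of \<open>K\<close> can be glued together.\<close>

lemma spread_all:
  "spread x (pi - \<alpha> / 2) {a..b}"
proof -
  define \<beta> where "\<beta> = pi - \<alpha> / 2"
  define loc where "loc \<tau> \<longleftrightarrow> (\<exists>\<delta>>0. spread x \<beta> ({a..b} \<inter> {\<tau> - \<delta>..\<tau> + \<delta>}))" for \<tau>
  define K where "K = {a..b} \<inter> {\<tau>. \<not> loc \<tau>}"
  have "open {\<tau>. loc \<tau>}"
  proof (rule openI)
    fix \<tau> assume "\<tau> \<in> {\<tau>. loc \<tau>}"
    then obtain \<delta> where \<delta>: "\<delta> > 0" "spread x \<beta> ({a..b} \<inter> {\<tau> - \<delta>..\<tau> + \<delta>})" by (auto simp: loc_def)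
    have "loc \<sigma>" if "\<sigma> \<in> ball \<tau> (\<delta> / 2)" for \<sigma>
    proof -
      have "\<tau> - \<delta> \<le> \<sigma> - \<delta> / 2" "\<sigma> + \<delta> / 2 \<le> \<tau> + \<delta>"
        using that unfolding mem_ball dist_real_def by linarith+
      then have "{a..b} \<inter> {\<sigma> - \<delta> / 2..\<sigma> + \<delta> / 2} \<subseteq> {a..b} \<inter> {\<tau> - \<delta>..\<tau> + \<delta>}" by auto
      from spread_subset[OF \<delta>(2) this] \<delta>(1) show ?thesis unfolding loc_def by (intro exI[of _ "\<delta> / 2"]) simp
    qed
    then show "\<exists>e>0. ball \<tau> e \<subseteq> {\<tau>. loc \<tau>}" using \<delta> by (intro exI[of _ "\<delta> / 2"]) auto
  qed
  then have "closed (- {\<tau>. loc \<tau>})" by (rule closed_Compl)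
  moreover have "K = {a..b} \<inter> - {\<tau>. loc \<tau>}" by (auto simp: K_def)
  ultimately have Kc: "closed K" by (simp only: closed_Int closed_real_atLeastAtMost)
  \<comment> \<open>Times inside a gap of K have neighbourhoods of small spread. Gluing from left to
    right covers every compact subinterval, and closure adds the endpoints.\<close>
  have gaps: "spread x \<beta> {c..d}" if H: "a \<le> c" "c < d" "d \<le> b" "K \<inter> {c<..<d} = {}" for c d
  proof (rule spread_closure)
    fix c' d' assume cd': "c < c'" "c' < d'" "d' < d"
    show "spread x \<beta> {c'..d'}" unfolding \<beta>_def
    proof (rule spread_local_to_global)
      fix \<tau> assume \<tau>: "c' \<le> \<tau>" "\<tau> < d'"
      then have "\<tau> \<in> {c<..<d}" "\<tau> \<in> {a..b}" using H cd' by auto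
      then have "loc \<tau>" using H(4) by (auto simp: K_def)
      then obtain \<delta> where \<delta>: "\<delta> > 0" "spread x \<beta> ({a..b} \<inter> {\<tau> - \<delta>..\<tau> + \<delta>})" by (auto simp: loc_def)
      show "\<exists>e>\<tau>. e \<le> d' \<and> spread x (pi - \<alpha> / 2) {\<tau>..e}"
        unfolding \<beta>_def[symmetric]
        by (intro exI[of _ "min d' (\<tau> + \<delta>)"] conjI spread_subset[OF \<delta>(2)])
           (use \<delta>(1) \<tau> cd' H in auto)
    qed (use H cd' in auto)
  qed (use H in \<open>auto intro: continuous_on_subset[OF cont]\<close>)
  have "K = {}"
  proof (rule ccontr)
    assume "K \<noteq> {}"
    \<comment> \<open>The lower speed bound is a closed condition that implies x m \<noteq> x
      \<tau>; the inequality of points alone would be lost in limits. One number n serves as both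
      time scale and speed scale.\<close>
    define E where "E n q = {m\<in>K. \<forall>\<tau>. m < \<tau> \<longrightarrow> \<tau> < m + 1 / real (Suc n) \<longrightarrow> \<tau> \<le> b \<longrightarrow>
      cos (\<alpha> / 8) * cmod (x \<tau> - x m) \<le> inner (cis q) (x \<tau> - x m) \<and>
      (\<tau> - m) * (1 / real (Suc n)) \<le> cmod (x \<tau> - x m)}" for n q
    have Ec: "closed (E n q)" for n q
      unfolding closed_sequential_limits
    proof (intro allI impI, elim conjE)
      fix f l assume f: "\<forall>k. f k \<in> E n q" and l: "f \<longlonglongrightarrow> l"
      have fK: "f k \<in> K" for k using f by (auto simp: E_def)
      then have "l \<in> K" using Kc l closed_sequentially by blast
      have xl: "(\<lambda>k. x (f k)) \<longlonglongrightarrow> x l"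
        by (rule continuous_on_tendsto_compose[OF cont l]) (use fK \<open>l \<in> K\<close> in \<open>auto simp: K_def\<close>)
      have "cos (\<alpha> / 8) * cmod (x \<tau> - x l) \<le> inner (cis q) (x \<tau> - x l) \<and>
         (\<tau> - l) * (1 / real (Suc n)) \<le> cmod (x \<tau> - x l)" if \<tau>: "l < \<tau>" "\<tau> < l + 1 / real (Suc n)" "\<tau> \<le> b" for \<tau>
      proof -
        have "\<forall>\<^sub>F k in sequentially. f k < \<tau>" by (rule order_tendstoD[OF l]) (use \<tau> in auto)
        moreover have "\<forall>\<^sub>F k in sequentially. \<tau> - 1 / real (Suc n) < f k" 
          by (rule order_tendstoD[OF l]) (use \<tau> in \<open>simp del: of_nat_Suc\<close>)
        ultimately have ev: "\<forall>\<^sub>F k in sequentially. cos (\<alpha> / 8) * cmod (x \<tau> - x (f k)) \<le> inner (cis q) (x \<tau> - x (f k)) \<and>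
         (\<tau> - f k) * (1 / real (Suc n)) \<le> cmod (x \<tau> - x (f k))"
        proof eventually_elim
          case (elim k)
          then have "\<tau> < f k + 1 / real (Suc n)" by linarith
          then show ?case using f elim \<tau> by (auto simp: E_def simp del: of_nat_Suc)
        qed
        have "cos (\<alpha> / 8) * cmod (x \<tau> - x l) \<le> inner (cis q) (x \<tau> - x l)"
          by (rule tendsto_le[OF _ tendsto_inner[OF tendsto_const tendsto_diff[OF tendsto_const xl]]
            tendsto_mult[OF tendsto_const tendsto_norm[OF tendsto_diff[OF tendsto_const xl]]]])
            (use ev in \<open>auto elim: eventually_mono\<close>)
        moreover have "(\<tau> - l) * (1 / real (Suc n)) \<le> cmod (x \<tau> - x l)"
          by (rule tendsto_le[OF _ tendsto_norm[OF tendsto_diff[OF tendsto_const xl]]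
            tendsto_mult[OF tendsto_diff[OF tendsto_const l] tendsto_const]])
            (use ev in \<open>auto elim: eventually_mono\<close>)
        ultimately show ?thesis ..
      qed
      then show "l \<in> E n q" using \<open>l \<in> K\<close> by (auto simp: E_def simp del: of_nat_Suc)
    qed
    have cover: "\<exists>n. \<exists>q\<in>\<rat>. m \<in> E n q" if "m \<in> K" for m
    proof (cases "m < b")
      case False
      \<comment> \<open>Here m = b, and no \<tau> lies between m and b.\<close>
      then have "m \<in> E 0 0" using that by (auto simp: E_def)
      then show ?thesis using Rats_0 by blast
    next
      case True
      then have m: "a \<le> m" "m < b" using that by (auto simp: K_def)
      have vm: "cmod (v m) > 0" using v_nz m by simp
      \<comment> \<open>A rational axis keeps the family countable. It misses the direction of v m
        by less than \<alpha> / 16, so the inequality for the cone of half-angle \<alpha> / 8 is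
        strict at v m.\<close>
      obtain q where q: "q \<in> \<rat>" "Arg (v m) < q" "q < Arg (v m) + \<alpha> / 16"
        using Rats_dense_in_real[of "Arg (v m)" "Arg (v m) + \<alpha> / 16"] alpha by auto
      have "cos (\<alpha> / 8) < cos (q - Arg (v m))"
        using q alpha by (intro cos_monotone_0_pi) auto
      moreover have "inner (cis q) (v m) = cmod (v m) * cos (q - Arg (v m))"
        using inner_of_real_cis[of 1 1 q "cmod (v m)" "Arg (v m)"] polar[of "v m"] by simp
      ultimately have "cos (\<alpha> / 8) * cmod (v m) < inner (cis q) (v m)" using vm by (simp add: mult.commute)
      from eventually_right_cone[OF m this]
      obtain f1 where f1: "m < f1" "\<And>s. m < s \<Longrightarrow> s < f1 \<Longrightarrow> cos (\<alpha> / 8) * cmod (x s - x m) < inner (cis q) (x s - x m)"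
        unfolding eventually_at_right_field by auto
      have "\<forall>\<^sub>F s in at_right m. cmod (v m) / 2 < cmod ((x s - x m) /\<^sub>R (s - m))"
        by (rule order_tendstoD[OF tendsto_norm[OF right_quotient[OF m]]]) (use vm in auto)
      then obtain f2 where f2: "m < f2" "\<And>s. m < s \<Longrightarrow> s < f2 \<Longrightarrow> cmod (v m) / 2 < cmod ((x s - x m) /\<^sub>R (s - m))"
        unfolding eventually_at_right_field by auto
      define \<eta> where "\<eta> = min (cmod (v m) / 2) (min (f1 - m) (f2 - m))"
      have "\<eta> > 0" using vm f1 f2 by (auto simp: \<eta>_def)
      then obtain n where n: "1 / real (Suc n) < \<eta>" using nat_approx_posE by (metis)
      have "m \<in> E n q" unfolding E_def
      proof (intro CollectI conjI allI impI that)
        fix \<tau> assume \<tau>: "m < \<tau>" "\<tau> < m + 1 / real (Suc n)"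
        then have "\<tau> < f1" "\<tau> < f2" using n by (auto simp: \<eta>_def simp del: of_nat_Suc)
        then show "cos (\<alpha> / 8) * cmod (x \<tau> - x m) \<le> inner (cis q) (x \<tau> - x m)"
          using f1(2)[of \<tau>] \<tau> by simp
        have "1 / real (Suc n) < cmod ((x \<tau> - x m) /\<^sub>R (\<tau> - m))"
          using f2(2)[of \<tau>] \<tau> n \<open>\<tau> < f2\<close> by (auto simp: \<eta>_def simp del: of_nat_Suc)
        then show "(\<tau> - m) * (1 / real (Suc n)) \<le> cmod (x \<tau> - x m)"
          unfolding norm_scaleR using \<tau> by (simp add: pos_less_divide_eq mult.commute less_imp_le divide_inverse_commute[symmetric] del: of_nat_Suc)
      qed
      then show ?thesis using q by blast
    qed
    \<comment> \<open>If K - E n q is not dense in K, then E n q contains a relatively open piece of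
      K.\<close>
    have "\<exists>n. \<exists>q\<in>\<rat>. \<not> K \<subseteq> closure (K - E n q)"
    proof (rule ccontr)
      assume dense: "\<not> ?thesis"
      define \<G> where "\<G> = (\<lambda>(n, q). K - E n q) ` (UNIV \<times> \<rat>)"
      have "K \<subseteq> closure (\<Inter>\<G>)"
      proof (rule Baire[OF Kc])
        show "countable \<G>" unfolding \<G>_def
          by (intro countable_image countable_SIGMA countable_rat) auto
      next
        fix T assume "T \<in> \<G>"
        then obtain n q where T: "T = K - E n q" "q \<in> \<rat>" by (auto simp: \<G>_def)
        have "openin (top_of_set K) (K \<inter> - E n q)" using Ec by (intro openin_open_Int) auto
        then show "openin (top_of_set K) T \<and> K \<subseteq> closure T" using T dense by (auto simp: Diff_eq)
      qed
      moreover have "\<Inter>\<G> = {}"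
      proof -
        \<comment> \<open>One member of the family confines the intersection to K, where the cover
          empties it.\<close>
        have "K - E 0 0 \<in> \<G>" unfolding \<G>_def using Rats_0 by (intro image_eqI[of _ _ "(0,0)"]) auto
        moreover have "m \<notin> \<Inter>\<G>" if "m \<in> K" for m
          using cover[OF that] by (force simp: \<G>_def)
        ultimately show ?thesis by blast
      qed
      ultimately show False using \<open>K \<noteq> {}\<close> by simp
    qed
    then obtain n q m where m: "m \<in> K" "m \<notin> closure (K - E n q)" by auto
    then have "open (- closure (K - E n q))" "m \<in> - closure (K - E n q)" by auto
    then obtain e where e: "e > 0" "ball m e \<subseteq> - closure (K - E n q)"
      by (meson openE)
    have eE: "k \<in> E n q" if "k \<in> K" "\<bar>k - m\<bar> < e" for k
      using e(2) that closure_subset[of "K - E n q"] by (force simp: dist_real_def abs_minus_commute)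
    \<comment> \<open>\<delta> < e keeps the window inside the uniform portion of K; a window
      shorter than 1 / (n + 1) lets each of its times in K control all later times of the
      window.\<close>
    define \<delta> where "\<delta> = min (e / 2) (1 / real (Suc n) / 3)"
    have \<delta>: "\<delta> > 0" "\<delta> < e" "2 * \<delta> < 1 / real (Suc n)"
    proof -
      have *: "min (e / 2) (N / 3) > 0 \<and> min (e / 2) (N / 3) < e \<and> 2 * min (e / 2) (N / 3) < N"
        if "0 < N" for N using e(1) that by (auto simp: min_def)
      have "0 < 1 / real (Suc n)" by simp
      from *[OF this] show "\<delta> > 0" "\<delta> < e" "2 * \<delta> < 1 / real (Suc n)"
        unfolding \<delta>_def by blast+
    qed
    define c d where "c = max a (m - \<delta>)" and "d = min b (m + \<delta>)"
    have mab: "a \<le> m" "m \<le> b" using m by (auto simp: K_def)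
    have cd: "a \<le> c" "c \<le> d" "d \<le> b" "d - c \<le> 2 * \<delta>" "m - \<delta> \<le> c" "d \<le> m + \<delta>"
      using mab \<delta> by (auto simp: c_def d_def)
    have "spread x (pi - \<alpha> / 2) {c..d}"
    proof (rule spread_of_gaps_direction[where P = "K \<inter> {c..d}" and w = "cis q"])
      fix k \<tau> assume H: "k \<in> K \<inter> {c..d}" "k < \<tau>" "\<tau> \<le> d"
      then have "k \<in> E n q" using eE[of k] cd \<delta> by auto
      moreover have "\<tau> < k + 1 / real (Suc n)" "\<tau> \<le> b" using H cd \<delta> by auto
      ultimately have "cos (\<alpha> / 8) * cmod (x \<tau> - x k) \<le> inner (cis q) (x \<tau> - x k)"
        "(\<tau> - k) * (1 / real (Suc n)) \<le> cmod (x \<tau> - x k)"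
        using H unfolding E_def by blast+
      moreover have "(\<tau> - k) * (1 / real (Suc n)) > 0" using H by simp
      ultimately show "x k \<noteq> x \<tau> \<and> cos (\<alpha> / 8) * cmod (x \<tau> - x k) \<le> inner (cis q) (x \<tau> - x k)"
        by auto
    next
      fix c' d' assume H: "c \<le> c'" "c' < d'" "d' \<le> d" "K \<inter> {c..d} \<inter> {c'<..<d'} = {}"
      then have "K \<inter> {c'<..<d'} = {}" by force
      then show "spread x (pi - \<alpha> / 2) {c'..d'}"
        using gaps[of c' d'] H cd by (simp add: \<beta>_def)
    qed (use cd Kc in auto)
    moreover have "{c..d} = {a..b} \<inter> {m - \<delta>..m + \<delta>}" by (auto simp: c_def d_def)
    ultimately have "spread x \<beta> ({a..b} \<inter> {m - \<delta>..m + \<delta>})" by (simp only: \<beta>_def)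
    then have "loc m" using \<delta> unfolding loc_def by blast
    then show False using m by (simp add: K_def)
  qed
  show ?thesis
  proof (cases "a < b")
    case True
    then show ?thesis using gaps[of a b] \<open>K = {}\<close> by (simp add: \<beta>_def)
  next
    case False
    then have "r = \<tau>" if "r \<in> {a..b}" "\<tau> \<in> {a..b}" for r \<tau> using that by auto
    then show ?thesis unfolding spread_def by (metis diff_self inner_zero_left mult_zero_left mult_zero_right norm_zero order_refl)
  qed
qed

end

section \<open>Length\<close>

context plane_eel begin

text \<open>The directions to the past fill an interval \<open>[l, h]\<close> of length at most \<open>pi - \<alpha> / 2\<close>, and the
  argument of the velocity lies in \<open>[h + \<alpha>, l + 2 * pi - \<alpha>]\<close>. The angle \<open>\<nu>\<close> of the direction \<open>n\<close> is
  the point nearest to it in \<open>[h + pi / 2 + \<eta>, l + 3 * pi / 2 - \<eta>]\<close>.\<close>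

lemma escape_direction:
  assumes \<tau>: "a \<le> \<tau>" "\<tau> < b"
  shows "\<exists>n. cmod n = 1 \<and> sin (\<alpha> / 8) * cmod (v \<tau>) \<le> inner n (v \<tau>) \<and>
    (\<forall>r\<in>{a..\<tau>}. inner n (x r - x \<tau>) \<le> - sin (\<alpha> / 8) * cmod (x r - x \<tau>))"
proof (cases "\<tau> = a")
  case True
  have "inner (sgn (v \<tau>)) (v \<tau>) = cmod (v \<tau>)"
    using v_nz[OF \<tau>] by (simp add: sgn_div_norm dot_square_norm power2_eq_square)
  moreover have "sin (\<alpha> / 8) * cmod (v \<tau>) \<le> 1 * cmod (v \<tau>)" by (intro mult_right_mono) auto
  ultimately show ?thesis
    using True v_nz[OF \<tau>] by (intro exI[of _ "sgn (v \<tau>)"]) (auto simp: norm_sgn)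
next
  case False
  then have "a < \<tau>" using \<tau> by simp
  define \<beta> where "\<beta> = pi - \<alpha> / 2"
  have \<beta>: "0 \<le> \<beta>" "\<beta> < pi" using alpha by (auto simp: \<beta>_def)
  have sp: "spread x \<beta> {a..b}" unfolding \<beta>_def by (rule spread_all)
  have nz: "x r \<noteq> x \<tau>" if "a \<le> r" "r < \<tau>" for r
    using spread_inj[OF sp _ _ \<beta>] that \<tau> by auto
  define w where "w = x a - x \<tau>"
  have w: "w \<noteq> 0" using nz \<open>a < \<tau>\<close> by (simp add: w_def)
  define \<phi> where "\<phi> r = Arg ((x r - x \<tau>) / w)" for r
  have pol: "x r - x \<tau> = of_real (cmod (x r - x \<tau>) / cmod w) * (w * cis (\<phi> r))" for r
    unfolding \<phi>_def by (rule polar_divide[OF w])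
  have "(x r - x \<tau>) / w \<notin> \<real>\<^sub>\<le>\<^sub>0" if "r \<in> {a..<\<tau>}" for r
    unfolding w_def using that \<tau> nz \<beta> \<open>a < \<tau>\<close> by (intro spread_not_nonpos[OF sp]) auto
  then have "continuous_on {a..<\<tau>} \<phi>"
    unfolding \<phi>_def using w \<tau> by (intro continuous_intros continuous_on_subset[OF cont]) auto
  then have conn: "connected (\<phi> ` {a..<\<tau>})" by (intro connected_continuous_image) auto
  have cosd: "cos \<beta> \<le> cos (\<phi> r - \<phi> r')" if "a \<le> r" "r < \<tau>" "a \<le> r'" "r' < \<tau>" for r r'
  proof -
    have pos: "cmod (x r - x \<tau>) * cmod (x r' - x \<tau>) > 0" using nz that by simp
    have "inner (x r - x \<tau>) (x r' - x \<tau>) = cmod (x r - x \<tau>) * cmod (x r' - x \<tau>) * cos (\<phi> r - \<phi> r')"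
      using inner_of_real_cis[of "cmod (x r - x \<tau>) / cmod w" w "\<phi> r" "cmod (x r' - x \<tau>) / cmod w" "\<phi> r'"] w
      unfolding pol[symmetric] by (simp add: power2_eq_square)
    then have "cos \<beta> * (cmod (x r - x \<tau>) * cmod (x r' - x \<tau>)) \<le> cos (\<phi> r - \<phi> r') * (cmod (x r - x \<tau>) * cmod (x r' - x \<tau>))"
      using spreadD[OF sp, of r r' \<tau>] that \<tau> by (simp add: mult.commute)
    then show ?thesis using mult_le_cancel_right_pos[OF pos] by blast
  qed
  \<comment> \<open>From cosines to real differences: one beyond pi would force a past point at
    exactly pi from another.\<close>
  have diff: "\<phi> r - \<phi> r' \<le> \<beta>" if H: "a \<le> r" "r < \<tau>" "a \<le> r'" "r' < \<tau>" for r r'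
  proof (rule ccontr)
    assume n: "\<not> ?thesis"
    show False
    proof (cases "\<phi> r - \<phi> r' \<le> pi")
      case True
      then have "cos (\<phi> r - \<phi> r') < cos \<beta>" using n \<beta> by (intro cos_monotone_0_pi) auto
      then show False using cosd[OF H] by simp
    next
      case False
      have "\<phi> r' + pi \<in> \<phi> ` {a..<\<tau>}"
        by (rule connectedD_interval[OF conn, of "\<phi> r'" "\<phi> r"]) (use H False in auto)
      then obtain \<rho> where "a \<le> \<rho>" "\<rho> < \<tau>" "\<phi> \<rho> = \<phi> r' + pi" by auto
      then have "cos \<beta> \<le> -1" using cosd[of \<rho> r'] H by auto
      then show False using cos_monotone_0_pi[of \<beta> pi] \<beta> by auto
    qed
  qed
  define \<theta> where "\<theta> = Arg (v \<tau> / w)"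
  have vp: "v \<tau> = of_real (cmod (v \<tau>) / cmod w) * (w * cis \<theta>)"
    unfolding \<theta>_def by (rule polar_divide[OF w])
  have vpos: "cmod (v \<tau>) > 0" using v_nz[OF \<tau>] by simp
  have margin: "cos (\<phi> r - \<theta>) \<le> cos \<alpha>" if "a \<le> r" "r < \<tau>" for r
  proof -
    have pos: "cmod (x r - x \<tau>) * cmod (v \<tau>) > 0" using nz that vpos by simp
    have "inner (x r - x \<tau>) (v \<tau>) = cmod (x r - x \<tau>) * cmod (v \<tau>) * cos (\<phi> r - \<theta>)"
      using inner_of_real_cis[of "cmod (x r - x \<tau>) / cmod w" w "\<phi> r" "cmod (v \<tau>) / cmod w" \<theta>] w
      unfolding pol[symmetric] vp[symmetric] by (simp add: power2_eq_square)
    then have "cos (\<phi> r - \<theta>) * (cmod (x r - x \<tau>) * cmod (v \<tau>)) \<le> cos \<alpha> * (cmod (x r - x \<tau>) * cmod (v \<tau>))"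
      using eel[of r \<tau>] that \<tau> by (simp add: mult_ac inner_commute)
    then show ?thesis using mult_le_cancel_right_pos[OF pos] by blast
  qed
  have out: "\<theta> \<notin> \<phi> ` {a..<\<tau>}"
  proof
    assume "\<theta> \<in> \<phi> ` {a..<\<tau>}"
    then obtain \<rho> where \<rho>: "a \<le> \<rho>" "\<rho> < \<tau>" "\<theta> = \<phi> \<rho>" by auto
    have "cos \<alpha> \<ge> 1" using margin[of \<rho>] \<rho> by simp
    then show False using cos_alpha_less_1 by simp
  qed
  have bnd: "\<bar>\<phi> r - \<theta>\<bar> \<le> 2 * pi" for r
    using Arg_bounded[of "(x r - x \<tau>) / w"] Arg_bounded[of "v \<tau> / w"] by (auto simp: \<phi>_def \<theta>_def)
  \<comment> \<open>The connected image of \<phi> omits \<theta> and so lies on one side of it. If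
    it lies above, adding 2 pi lifts the velocity above all past directions.\<close>
  obtain \<theta>' where \<theta>': "cis \<theta>' = cis \<theta>" "\<And>r. a \<le> r \<Longrightarrow> r < \<tau> \<Longrightarrow> \<alpha> \<le> \<theta>' - \<phi> r \<and> \<theta>' - \<phi> r \<le> 2 * pi - \<alpha>"
  proof (cases "\<phi> a < \<theta>")
    case True
    have below: "\<phi> r < \<theta>" if "a \<le> r" "r < \<tau>" for r
    proof (rule ccontr)
      assume n: "\<not> \<phi> r < \<theta>"
      have "\<theta> \<in> \<phi> ` {a..<\<tau>}"
        by (rule connectedD_interval[OF conn, of "\<phi> a" "\<phi> r"]) (use True n that \<open>a < \<tau>\<close> in auto)
      then show False using out by simp
    qed
    have "\<alpha> \<le> \<theta> - \<phi> r \<and> \<theta> - \<phi> r \<le> 2 * pi - \<alpha>" if r: "a \<le> r" "r < \<tau>" for r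
    proof -
      have "cos (\<theta> - \<phi> r) \<le> cos \<alpha>" using margin[OF r] cos_minus[of "\<theta> - \<phi> r"] by simp
      from cos_le_cos_range[OF this] below[OF r] bnd[of r] alpha show ?thesis by auto
    qed
    then show ?thesis using that[of \<theta>] by simp
  next
    case False
    have above: "\<phi> r > \<theta>" if "a \<le> r" "r < \<tau>" for r
    proof (rule ccontr)
      assume n: "\<not> \<phi> r > \<theta>"
      have "\<theta> \<in> \<phi> ` {a..<\<tau>}"
        by (rule connectedD_interval[OF conn, of "\<phi> r" "\<phi> a"]) (use False n that \<open>a < \<tau>\<close> in auto)
      then show False using out by simp
    qed
    have "\<alpha> \<le> \<theta> + 2 * pi - \<phi> r \<and> \<theta> + 2 * pi - \<phi> r \<le> 2 * pi - \<alpha>" if r: "a \<le> r" "r < \<tau>" for r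
      using cos_le_cos_range[OF margin[OF r]] above[OF r] bnd[of r] alpha by auto
    moreover have "cis (\<theta> + 2 * pi) = cis \<theta>" by (simp add: cis_mult[symmetric])
    ultimately show ?thesis using that[of "\<theta> + 2 * pi"] by simp
  qed
  define l h where "l = Inf (\<phi> ` {a..<\<tau>})" and "h = Sup (\<phi> ` {a..<\<tau>})"
  have ne: "\<phi> ` {a..<\<tau>} \<noteq> {}" using \<open>a < \<tau>\<close> by auto
  have hub: "h \<le> y" if "\<And>r. a \<le> r \<Longrightarrow> r < \<tau> \<Longrightarrow> \<phi> r \<le> y" for y
    unfolding h_def using ne that by (intro cSup_least) auto
  have llb: "y \<le> l" if "\<And>r. a \<le> r \<Longrightarrow> r < \<tau> \<Longrightarrow> y \<le> \<phi> r" for y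
    unfolding l_def using ne that by (intro cInf_greatest) auto
  have bd: "bdd_above (\<phi> ` {a..<\<tau>})" "bdd_below (\<phi> ` {a..<\<tau>})"
    using mpi_less_Arg Arg_le_pi
    by (auto simp: \<phi>_def less_imp_le intro!: bdd_aboveI[of _ pi] bdd_belowI[of _ "-pi"])
  have lh: "l \<le> \<phi> r" "\<phi> r \<le> h" if "a \<le> r" "r < \<tau>" for r
    unfolding l_def h_def using bd that by (auto intro: cInf_lower cSup_upper)
  have "h \<le> \<phi> r + \<beta>" if "a \<le> r" "r < \<tau>" for r
    using diff that by (intro hub) (smt (verit))
  then have "h - \<beta> \<le> l" by (intro llb) (smt (verit))
  have t1: "h \<le> \<theta>' - \<alpha>" using \<theta>'(2) by (intro hub) (smt (verit))
  have t2: "\<theta>' - 2 * pi + \<alpha> \<le> l" using \<theta>'(2) by (intro llb) (smt (verit))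
  \<comment> \<open>Since h - l is at most pi - \<alpha> / 2, this choice leaves the interval for
    \<nu> a length of at least \<alpha> / 4; and 2 * \<eta> \<le> \<alpha> keeps \<nu> within pi / 2
    - \<eta> of \<theta>'.\<close>
  define \<eta> where "\<eta> = \<alpha> / 8"
  define \<nu> where "\<nu> = max (h + pi / 2 + \<eta>) (min \<theta>' (l + 3 * pi / 2 - \<eta>))"
  have \<nu>1: "h + pi / 2 + \<eta> \<le> \<nu>" "\<nu> \<le> l + 3 * pi / 2 - \<eta>"
    using \<open>h - \<beta> \<le> l\<close> alpha by (auto simp: \<nu>_def \<beta>_def \<eta>_def)
  have \<nu>2: "\<bar>\<nu> - \<theta>'\<bar> \<le> pi / 2 - \<eta>"
    using t1 t2 alpha \<open>h - \<beta> \<le> l\<close> unfolding \<nu>_def \<eta>_def \<beta>_def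
    by (simp add: max_def min_def abs_le_iff)
  have sin_cos: "cos (pi / 2 - \<eta>) = sin \<eta>" by (simp add: cos_diff)
  have near: "sin \<eta> \<le> cos t" if "\<bar>t\<bar> \<le> pi / 2 - \<eta>" for t
    using cos_monotone_0_pi_le[of "\<bar>t\<bar>" "pi / 2 - \<eta>"] that alpha sin_cos by (simp add: \<eta>_def)
  define n where "n = of_real (1 / cmod w) * (w * cis \<nu>)"
  have n1: "cmod n = 1" using w by (simp add: n_def norm_mult norm_divide)
  have vp': "v \<tau> = of_real (cmod (v \<tau>) / cmod w) * (w * cis \<theta>')" using vp \<theta>'(1) by simp
  have "inner n (v \<tau>) = cmod (v \<tau>) * cos (\<nu> - \<theta>')"
    using inner_of_real_cis[of "1 / cmod w" w \<nu> "cmod (v \<tau>) / cmod w" \<theta>'] w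
    unfolding n_def[symmetric] vp'[symmetric] by (simp add: power2_eq_square)
  moreover have "sin \<eta> * cmod (v \<tau>) \<le> cos (\<nu> - \<theta>') * cmod (v \<tau>)"
    using near[OF \<nu>2] by (intro mult_right_mono) auto
  ultimately have n2: "sin \<eta> * cmod (v \<tau>) \<le> inner n (v \<tau>)" by (simp add: mult.commute)
  have n3: "inner n (x r - x \<tau>) \<le> - sin \<eta> * cmod (x r - x \<tau>)" if "r \<in> {a..\<tau>}" for r
  proof (cases "r = \<tau>")
    case False
    then have r: "a \<le> r" "r < \<tau>" using that by auto
    have "inner n (x r - x \<tau>) = cmod (x r - x \<tau>) * cos (\<nu> - \<phi> r)"
      using inner_of_real_cis[of "1 / cmod w" w \<nu> "cmod (x r - x \<tau>) / cmod w" "\<phi> r"] w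
      unfolding n_def[symmetric] pol[symmetric] by (simp add: power2_eq_square)
    moreover have "\<bar>\<nu> - \<phi> r - pi\<bar> \<le> pi / 2 - \<eta>" using \<nu>1 lh[OF r] by auto
    then have "sin \<eta> \<le> cos (\<nu> - \<phi> r - pi)" by (rule near)
    then have "cos (\<nu> - \<phi> r) \<le> - sin \<eta>" by (simp add: cos_diff[of _ pi])
    then have "cmod (x r - x \<tau>) * cos (\<nu> - \<phi> r) \<le> cmod (x r - x \<tau>) * - sin \<eta>"
      by (intro mult_left_mono) auto
    ultimately show ?thesis by (simp add: mult.commute)
  qed simp
  show ?thesis using n1 n2 n3 unfolding \<eta>_def by blast
qed

text \<open>Along a direction \<open>n\<close> close to an escape direction the current position is extremal, so the
  support function \<open>G n\<close> of the past grows at least proportionally to the displacement.\<close>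

lemma length_bound:
  assumes D: "finite D" "\<And>n. n \<in> D \<Longrightarrow> cmod n = 1"
    and net: "\<And>\<nu>. cmod \<nu> = 1 \<Longrightarrow> \<exists>n\<in>D. cmod (n - \<nu>) < sin (\<alpha> / 8) / 2"
    and M: "\<And>\<tau>. \<tau> \<in> {a..b} \<Longrightarrow> cmod (x \<tau>) \<le> M"
    and ts: "sorted_wrt (<) ts" "set ts \<subseteq> {a..b}" "ts \<noteq> []"
  shows "(\<Sum>i<length ts - 1. dist (x (ts ! i)) (x (ts ! Suc i))) \<le> (8 * real (card D) / sin (\<alpha> / 8)) * M"
proof -
  define c where "c = sin (\<alpha> / 8)"
  have c: "c > 0" using alpha unfolding c_def by (intro sin_gt_zero) auto
  define G where "G n \<tau> = Sup ((\<lambda>r. inner n (x r)) ` {a..\<tau>})" for n \<tau>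
  define F where "F \<tau> = (\<Sum>n\<in>D. G n \<tau>)" for \<tau>
  have bdd: "bdd_above ((\<lambda>r. inner n (x r)) ` {a..\<tau>})" if "\<tau> \<le> b" for n \<tau>
  proof -
    have "continuous_on {a..\<tau>} (\<lambda>r. inner n (x r))"
      by (intro continuous_intros continuous_on_subset[OF cont]) (use that in auto)
    then have "compact ((\<lambda>r. inner n (x r)) ` {a..\<tau>})" by (intro compact_continuous_image) auto
    then show ?thesis by (intro bounded_imp_bdd_above compact_imp_bounded)
  qed
  have Gup: "inner n (x r) \<le> G n \<tau>" if "a \<le> r" "r \<le> \<tau>" "\<tau> \<le> b" for n r \<tau>
    unfolding G_def using bdd that by (intro cSup_upper) auto
  have Gmono: "G n \<sigma> \<le> G n \<tau>" if "a \<le> \<sigma>" "\<sigma> \<le> \<tau>" "\<tau> \<le> b" for n \<sigma> \<tau>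
    unfolding G_def using bdd that by (intro cSup_subset_mono) auto
  have Gle: "G n \<tau> \<le> y" if "a \<le> \<tau>" "\<And>r. a \<le> r \<Longrightarrow> r \<le> \<tau> \<Longrightarrow> inner n (x r) \<le> y" for n \<tau> y
    unfolding G_def using that by (intro cSup_least) auto
  have Fmono: "F \<sigma> \<le> F \<tau>" if "a \<le> \<sigma>" "\<sigma> \<le> \<tau>" "\<tau> \<le> b" for \<sigma> \<tau>
    unfolding F_def using Gmono that by (intro sum_mono)
  have step: "\<forall>\<^sub>F s in at_right \<tau>. c / 4 * cmod (x s - x \<tau>) \<le> F s - F \<tau>" if \<tau>: "a \<le> \<tau>" "\<tau> < b" for \<tau>
  proof -
    obtain \<nu> where \<nu>: "cmod \<nu> = 1" "c * cmod (v \<tau>) \<le> inner \<nu> (v \<tau>)"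
      "\<And>r. a \<le> r \<Longrightarrow> r \<le> \<tau> \<Longrightarrow> inner \<nu> (x r - x \<tau>) \<le> - c * cmod (x r - x \<tau>)"
      using escape_direction[OF \<tau>] unfolding c_def by auto
    obtain n where n: "n \<in> D" "cmod (n - \<nu>) < c / 2" using net[OF \<nu>(1)] unfolding c_def by auto
    have near: "\<bar>inner n z - inner \<nu> z\<bar> \<le> c / 2 * cmod z" for z
    proof -
      have "\<bar>inner (n - \<nu>) z\<bar> \<le> cmod (n - \<nu>) * cmod z" by (rule Cauchy_Schwarz_ineq2)
      also have "\<dots> \<le> c / 2 * cmod z" using n by (intro mult_right_mono) auto
      finally show ?thesis by (simp add: inner_diff_left)
    qed
    have "cmod (v \<tau>) > 0" using v_nz \<tau> by simp
    \<comment> \<open>The escape direction gives c, its replacement by a net point costs c / 2, and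
      c / 4 leaves the strictness needed to pass from velocity to displacement.\<close>
    then have "c / 4 * cmod (v \<tau>) < c / 2 * cmod (v \<tau>)" using c by simp
    also have "\<dots> \<le> inner n (v \<tau>)" using near[of "v \<tau>"] \<nu>(2) unfolding abs_le_iff by linarith
    finally have "\<forall>\<^sub>F s in at_right \<tau>. c / 4 * cmod (x s - x \<tau>) < inner n (x s - x \<tau>)"
      by (rule eventually_right_cone[OF \<tau>])
    then show ?thesis using eventually_at_right_real[OF \<tau>(2)]
    proof eventually_elim
      case (elim s)
      have "inner n (x r) \<le> inner n (x \<tau>)" if "a \<le> r" "r \<le> \<tau>" for r
      proof -
        have "inner n (x r - x \<tau>) \<le> - c * cmod (x r - x \<tau>) + c / 2 * cmod (x r - x \<tau>)"
          using near[of "x r - x \<tau>"] \<nu>(3)[OF that] by linarith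
        also have "\<dots> \<le> 0" using c by simp
        finally show ?thesis by (simp add: inner_diff_right)
      qed
      then have "G n \<tau> \<le> inner n (x \<tau>)" using \<tau> by (intro Gle) auto
      moreover have "inner n (x s) \<le> G n s" using elim \<tau> by (intro Gup) auto
      ultimately have "c / 4 * cmod (x s - x \<tau>) \<le> G n s - G n \<tau>" using elim by (simp add: inner_diff_right)
      \<comment> \<open>The past only grows, so no support function decreases. The fixed sum F can
        thus stand in for the one summand that depends on \<tau>.\<close>
      also have "\<dots> \<le> (\<Sum>n\<in>D. G n s - G n \<tau>)"
        using n(1) D(1) Gmono[of \<tau> s] \<tau> elim by (intro member_le_sum[of n D "\<lambda>n. G n s - G n \<tau>"]) auto
      finally show ?case by (simp add: F_def sum_subtractf)
    qed
  qed
  have incr: "c / 4 * cmod (x \<tau> - x \<sigma>) \<le> F \<tau> - F \<sigma>" if \<sigma>\<tau>: "a \<le> \<sigma>" "\<sigma> \<le> \<tau>" "\<tau> \<le> b" for \<sigma> \<tau>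
  proof -
    define T where "T = {m\<in>{\<sigma>..\<tau>}. c / 4 * cmod (x m - x \<sigma>) \<le> F m - F \<sigma>}"
    define m where "m = Sup T"
    have sT: "\<sigma> \<in> T" using \<sigma>\<tau> by (simp add: T_def)
    have bT: "bdd_above T" by (auto simp: T_def)
    have m: "\<sigma> \<le> m" "m \<le> \<tau>"
      using sT bT unfolding m_def by (auto intro!: cSup_upper cSup_least) (auto simp: T_def)
    \<comment> \<open>Monotonicity of F replaces continuity here: approaching m from the left, F m'
      \<le> F m, while the displacement is continuous.\<close>
    have "m \<in> T"
    proof (rule ccontr)
      assume "m \<notin> T"
      then have gt: "F m - F \<sigma> < c / 4 * cmod (x m - x \<sigma>)" using m by (auto simp: T_def)
      have "((\<lambda>s. c / 4 * cmod (x s - x \<sigma>)) \<longlongrightarrow> c / 4 * cmod (x m - x \<sigma>)) (at m within {a..b})"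
        using cont m \<sigma>\<tau> by (intro tendsto_intros) (auto simp: continuous_on_def)
      then have "\<forall>\<^sub>F s in at m within {a..b}. F m - F \<sigma> < c / 4 * cmod (x s - x \<sigma>)"
        using gt by (rule order_tendstoD)
      then obtain e where e: "e > 0" "\<And>s. s \<in> {a..b} \<Longrightarrow> s \<noteq> m \<Longrightarrow> dist s m < e \<Longrightarrow> F m - F \<sigma> < c / 4 * cmod (x s - x \<sigma>)"
        unfolding eventually_at by blast
      obtain m' where m': "m' \<in> T" "m - e < m'"
        using less_cSup_iff[of T "m - e"] sT bT e(1) by (auto simp: m_def)
      have "m' \<le> m" unfolding m_def using m' bT by (intro cSup_upper)
      moreover have "m' \<noteq> m" using m' \<open>m \<notin> T\<close> by auto
      moreover have "m' \<in> {a..b}" using m' \<sigma>\<tau> by (auto simp: T_def)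
      ultimately have "F m - F \<sigma> < c / 4 * cmod (x m' - x \<sigma>)"
        using m' by (intro e(2)) (auto simp: dist_real_def)
      also have "\<dots> \<le> F m' - F \<sigma>" using m' by (simp add: T_def)
      also have "\<dots> \<le> F m - F \<sigma>" using Fmono[of m' m] \<open>m' \<le> m\<close> \<open>m' \<in> {a..b}\<close> m \<sigma>\<tau> by auto
      finally show False by simp
    qed
    have "m = \<tau>"
    proof (rule ccontr)
      assume "m \<noteq> \<tau>"
      then have "m < \<tau>" using m by simp
      have "\<forall>\<^sub>F s in at_right m. s \<in> {m<..<\<tau>} \<and> c / 4 * cmod (x s - x m) \<le> F s - F m"
        using m \<sigma>\<tau> \<open>m < \<tau>\<close> by (intro eventually_conj eventually_at_right_real step) auto
      then obtain s where s: "m < s" "s < \<tau>" "c / 4 * cmod (x s - x m) \<le> F s - F m"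
        using eventually_happens[of _ "at_right m"] by auto
      have "c / 4 * cmod (x s - x \<sigma>) \<le> c / 4 * (cmod (x s - x m) + cmod (x m - x \<sigma>))"
        using c norm_triangle_ineq[of "x s - x m" "x m - x \<sigma>"] by (intro mult_left_mono) auto
      also have "\<dots> \<le> F s - F \<sigma>" using s(3) \<open>m \<in> T\<close> by (simp add: T_def distrib_left)
      finally have "s \<in> T" using s m by (simp add: T_def)
      then have "s \<le> m" unfolding m_def using bT by (intro cSup_upper)
      then show False using s by simp
    qed
    then show ?thesis using \<open>m \<in> T\<close> by (simp add: T_def)
  qed
  have Fb: "\<bar>F \<tau>\<bar> \<le> real (card D) * M" if \<tau>: "\<tau> \<in> {a..b}" for \<tau>
  proof -
    have "\<bar>G n \<tau>\<bar> \<le> M" if "n \<in> D" for n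
    proof -
      have i: "\<bar>inner n (x r)\<bar> \<le> M" if "r \<in> {a..b}" for r
        using Cauchy_Schwarz_ineq2[of n "x r"] D(2)[OF \<open>n \<in> D\<close>] M[OF that] by simp
      have "G n \<tau> \<le> M" using i \<tau> by (intro Gle) (auto simp: abs_le_iff)
      moreover have "- M \<le> inner n (x \<tau>)" using i[OF \<tau>] by (simp add: abs_le_iff)
      moreover have "inner n (x \<tau>) \<le> G n \<tau>" using \<tau> by (intro Gup) auto
      ultimately show ?thesis by simp
    qed
    then have "(\<Sum>n\<in>D. \<bar>G n \<tau>\<bar>) \<le> real (card D) * M" by (intro sum_bounded_above) auto
    then show ?thesis unfolding F_def by (rule order_trans[OF sum_abs])
  qed
  have inc: "ts ! i \<le> ts ! Suc i" if "i < length ts - 1" for i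
    using that by (intro less_imp_le sorted_wrt_nth_less[OF ts(1)]) auto
  have in_ab: "ts ! i \<in> {a..b}" if "i < length ts" for i using ts(2) nth_mem[OF that] by blast
  have "(\<Sum>i<length ts - 1. dist (x (ts ! i)) (x (ts ! Suc i)))
      \<le> (\<Sum>i<length ts - 1. 4 / c * (F (ts ! Suc i) - F (ts ! i)))"
  proof (intro sum_mono)
    fix i assume "i \<in> {..<length ts - 1}"
    then have i: "i < length ts - 1" by simp
    have "c / 4 * cmod (x (ts ! Suc i) - x (ts ! i)) \<le> F (ts ! Suc i) - F (ts ! i)"
      using inc[OF i] in_ab[of i] in_ab[of "Suc i"] i by (intro incr) auto
    then show "dist (x (ts ! i)) (x (ts ! Suc i)) \<le> 4 / c * (F (ts ! Suc i) - F (ts ! i))"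
      using c by (simp add: dist_norm norm_minus_commute field_simps)
  qed
  also have "\<dots> = 4 / c * (F (ts ! (length ts - 1)) - F (ts ! 0))"
    by (simp only: sum_distrib_left[symmetric] sum_lessThan_telescope[of "\<lambda>i. F (ts ! i)"])
  also have "\<dots> \<le> 4 / c * (2 * (real (card D) * M))"
    using Fb[OF in_ab[of "length ts - 1"]] Fb[OF in_ab[of 0]] ts(3) c
    by (intro mult_left_mono) (auto simp: abs_le_iff)
  finally show ?thesis by (simp add: c_def)
qed

end

text \<open>Total boundedness of the unit circle. The net depends on e alone, which makes the length
  bound uniform over all compact subintervals.\<close>

lemma finite_direction_net:
  assumes "e > 0"
  obtains D :: "complex set" where "finite D" "\<And>n. n \<in> D \<Longrightarrow> cmod n = 1"
    "\<And>\<nu>. cmod \<nu> = 1 \<Longrightarrow> \<exists>n\<in>D. cmod (n - \<nu>) < e"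
proof -
  have "seq_compact (sphere (0::complex) 1)" by (simp add: compact_imp_seq_compact)
  from seq_compact_imp_totally_bounded[OF this, rule_format, OF assms]
  obtain D where D: "finite D" "D \<subseteq> sphere (0::complex) 1" "sphere 0 1 \<subseteq> (\<Union>n\<in>D. ball n e)"
    by (elim exE conjE)
  have "\<exists>n\<in>D. cmod (n - \<nu>) < e" if "cmod \<nu> = 1" for \<nu>
  proof -
    have "\<nu> \<in> (\<Union>n\<in>D. ball n e)" using that by (intro subsetD[OF D(3)]) auto
    then show ?thesis by (auto simp: dist_norm)
  qed
  moreover have "cmod n = 1" if "n \<in> D" for n using subsetD[OF D(2) that] by simp
  ultimately show ?thesis using D(1) that by blast
qed

section \<open>Transfer from the Euclidean plane to the complex numbers\<close>

definition to_complex :: "real^2 \<Rightarrow> complex" where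
  "to_complex z = Complex (z $ 1) (z $ 2)"

lemma inner_to_complex [simp]: "inner (to_complex z) (to_complex w) = inner z w"
  by (simp add: to_complex_def inner_complex_def inner_vec_def sum_2)

lemma linear_to_complex: "linear to_complex"
  by (rule linearI) (simp_all add: to_complex_def complex_eq_iff)

lemma norm_to_complex [simp]: "cmod (to_complex z) = norm z"
  by (simp add: norm_eq_sqrt_inner)

lemma to_complex_diff: "to_complex (z - w) = to_complex z - to_complex w"
  by (rule linear_diff[OF linear_to_complex])

lemma dist_to_complex: "dist (to_complex z) (to_complex w) = dist z w"
  by (simp add: dist_norm flip: to_complex_diff)

lemma bounded_linear_to_complex: "bounded_linear to_complex"
  using linear_to_complex by (simp add: linear_conv_bounded_linear)

theorem theorem5p3:
  fixes lam :: real and I :: "real set" and \<gamma> :: "real \<Rightarrow> real^2"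
  assumes "-1 \<le> lam" and "lam < 1"
    and "is_interval I"
    and "is_eel lam I \<gamma>"
    and "bounded (\<gamma> ` I)"
  shows "rectifiable_curve \<gamma> I \<and> curve_length \<gamma> I < \<infinity>"
proof -
  \<comment> \<open>Raising \<lambda> weakens the eel inequality; a nonnegative value gives \<alpha>
    \<le> pi / 2.\<close>
  define \<mu> where "\<mu> = max lam 0"
  have \<mu>: "0 \<le> \<mu>" "\<mu> < 1" "lam \<le> \<mu>" using assms by (auto simp: \<mu>_def)
  define \<alpha> where "\<alpha> = arccos \<mu>"
  have cos\<alpha>: "cos \<alpha> = \<mu>" using \<mu> by (simp add: \<alpha>_def)
  have \<alpha>: "0 < \<alpha>" "\<alpha> \<le> pi / 2"
    using \<mu> arccos_less_arccos[of \<mu> 1] arccos_le_pi2[of \<mu>] by (auto simp: \<alpha>_def)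
  have "sin (\<alpha> / 8) / 2 > 0" using \<alpha> sin_gt_zero[of "\<alpha> / 8"] by simp
  then obtain D where D: "finite D" "\<And>n. n \<in> D \<Longrightarrow> cmod n = 1"
    "\<And>\<nu>. cmod \<nu> = 1 \<Longrightarrow> \<exists>n\<in>D. cmod (n - \<nu>) < sin (\<alpha> / 8) / 2"
    using finite_direction_net by blast
  obtain M where M: "\<And>\<tau>. \<tau> \<in> I \<Longrightarrow> norm (\<gamma> \<tau>) \<le> M"
    using assms(5) by (auto simp: bounded_iff)
  have cont: "continuous_on I \<gamma>" using assms(4) by (simp add: is_eel_def)
  have "\<forall>\<tau>\<in>I. \<exists>v. v \<noteq> 0 \<and> (\<gamma> has_vector_derivative v) (at \<tau> within (I \<inter> {\<tau><..})) \<and>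
        (\<forall>t\<in>I. t < \<tau> \<longrightarrow> inner v (\<gamma> t - \<gamma> \<tau>) \<le> lam * norm v * norm (\<gamma> t - \<gamma> \<tau>))"
    using assms(4) by (simp add: is_eel_def)
  then obtain v where v: "\<And>\<tau>. \<tau> \<in> I \<Longrightarrow> v \<tau> \<noteq> 0"
    "\<And>\<tau>. \<tau> \<in> I \<Longrightarrow> (\<gamma> has_vector_derivative v \<tau>) (at \<tau> within (I \<inter> {\<tau><..}))"
    "\<And>\<tau> t. \<tau> \<in> I \<Longrightarrow> t \<in> I \<Longrightarrow> t < \<tau> \<Longrightarrow> inner (v \<tau>) (\<gamma> t - \<gamma> \<tau>) \<le> lam * norm (v \<tau>) * norm (\<gamma> t - \<gamma> \<tau>)"
    by metis
  \<comment> \<open>The maximum with 0 covers the empty list, as M may be negative when I is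
    empty.\<close>
  define C where "C = max 0 ((8 * real (card D) / sin (\<alpha> / 8)) * M)"
  have bound: "(\<Sum>i<length ts - 1. dist (\<gamma> (ts ! i)) (\<gamma> (ts ! Suc i))) \<le> C"
    if ts: "sorted_wrt (<) ts" "set ts \<subseteq> I" for ts
  proof (cases "ts = []")
    case True
    then show ?thesis by (simp add: C_def)
  next
    case False
    \<comment> \<open>I may be unbounded or lack endpoints; each finite sequence lives on the
      compact interval between its first and last entry, and C does not depend on it.\<close>
    define a b where "a = ts ! 0" and "b = ts ! (length ts - 1)"
    have abI: "a \<in> I" "b \<in> I" using ts False by (auto simp: a_def b_def)
    have sub: "{a..b} \<subseteq> I"
      using mem_is_interval_1_I[OF assms(3) abI] by auto
    have sorted: "sorted ts" using ts(1) strict_sorted_imp_sorted by blast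
    have tsab: "set ts \<subseteq> {a..b}"
    proof
      fix y assume "y \<in> set ts"
      then obtain i where "i < length ts" "y = ts ! i" by (auto simp: in_set_conv_nth)
      then show "y \<in> {a..b}"
        using sorted_nth_mono[OF sorted, of 0 i] sorted_nth_mono[OF sorted, of i "length ts - 1"]
        by (auto simp: a_def b_def)
    qed
    interpret plane_eel a b \<alpha> "\<lambda>\<tau>. to_complex (\<gamma> \<tau>)" "\<lambda>\<tau>. to_complex (v \<tau>)"
    proof
      show "continuous_on {a..b} (\<lambda>\<tau>. to_complex (\<gamma> \<tau>))"
        by (intro bounded_linear.continuous_on[OF bounded_linear_to_complex] continuous_on_subset[OF cont sub])
    next
      fix \<tau> assume \<tau>: "a \<le> \<tau>" "\<tau> < b"
      then have \<tau>I: "\<tau> \<in> I" using sub by auto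
      \<comment> \<open>Every time strictly between \<tau> and b belongs to I, so the derivative
        relative to I is the full right derivative.\<close>
      have "at \<tau> within (I \<inter> {\<tau><..}) = at_right \<tau>"
        by (rule at_within_nhd[of _ "{..<b}"]) (use \<tau> sub in auto)
      then show "((\<lambda>\<tau>. to_complex (\<gamma> \<tau>)) has_vector_derivative to_complex (v \<tau>)) (at_right \<tau>)"
        using bounded_linear.has_vector_derivative[OF bounded_linear_to_complex v(2)[OF \<tau>I]] by simp
      show "to_complex (v \<tau>) \<noteq> 0"
        using v(1)[OF \<tau>I] by (metis norm_eq_zero norm_to_complex)
    next
      fix r \<tau> assume r: "a \<le> r" "r < \<tau>" "\<tau> < b"
      have "inner (v \<tau>) (\<gamma> r - \<gamma> \<tau>) \<le> lam * (norm (v \<tau>) * norm (\<gamma> r - \<gamma> \<tau>))"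
        using v(3)[of \<tau> r] r subsetD[OF sub, of r] subsetD[OF sub, of \<tau>] by (simp add: mult.assoc)
      also have "\<dots> \<le> \<mu> * (norm (v \<tau>) * norm (\<gamma> r - \<gamma> \<tau>))" using \<mu> by (intro mult_right_mono) auto
      finally show "inner (to_complex (v \<tau>)) (to_complex (\<gamma> r) - to_complex (\<gamma> \<tau>))
        \<le> cos \<alpha> * (cmod (to_complex (v \<tau>)) * cmod (to_complex (\<gamma> r) - to_complex (\<gamma> \<tau>)))"
        by (simp add: cos\<alpha> flip: to_complex_diff)
    qed (use \<alpha> in auto)
    have "(\<Sum>i<length ts - 1. dist (to_complex (\<gamma> (ts ! i))) (to_complex (\<gamma> (ts ! Suc i))))
       \<le> (8 * real (card D) / sin (\<alpha> / 8)) * M"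
      by (rule length_bound[OF D]) (use M sub ts tsab False in auto)
    then show ?thesis by (simp add: dist_to_complex C_def)
  qed
  have "curve_length \<gamma> I \<le> ennreal C"
    unfolding curve_length_def using bound by (intro SUP_least ennreal_leI) auto
  also have "\<dots> < \<infinity>" by simp
  finally have fin: "curve_length \<gamma> I < \<infinity>" .
  moreover have "rectifiable_curve \<gamma> I"
    unfolding rectifiable_curve_def
  proof (intro allI impI)
    fix a b assume "{a..b} \<subseteq> I"
    then have "curve_length \<gamma> {a..b} \<le> curve_length \<gamma> I"
      unfolding curve_length_def by (intro SUP_subset_mono) auto
    then show "curve_length \<gamma> {a..b} < \<infinity>" using fin by (rule le_less_trans)
  qed
  ultimately show ?thesis by simp
qed

end
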